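(* Let $n\ge3$. (Direct part) Assume that $\psi\in\mathcal A$ with $\lim_{r\to+\infty}\psi(r)=+\infty$, and that there exists a positive function $h\in C^1(\mathbb R)$ satisfying $$\text{(i)}\quad \lim_{\tau\to+\infty}\frac{h'(\tau)}{h(\tau)}=0,$$ $$\text{(ii)}\quad \lim_{\tau\to+\infty}\frac{h\left(\tau+\frac1{n-1}\log h(\tau)+\frac1{n-1}\log\left(\frac{n-1}{n-2}\right)+o(1)\right)}{h(\tau)}=1,$$ such that $$\text{(iii)}\quad \lim_{r\to+\infty}\frac{(\log\psi(r))'}{h(\log\psi(r))}=1.$$ Let the change of variables $r\in(0,+\infty)\leftrightarrow s\in(0,+\infty)$ and the weight $\rho$ be defined by $$\frac1{(n-2)\,s^{n-2}}=\int_r^{+\infty}\frac{1}{[\psi(t)]^{n-1}}\,dt,\qquad \rho(s)=\frac{[\psi(r(s))]^{2(n-1)}}{s^{2(n-1)}}\quad\forall s\in(0,+\infty).$$ Then $\rho$ belongs to $\mathcal B$ and obeys the asymptotic laws $$\text{(iv)}\quad \rho(s)\sim\frac{\left(\frac{n-2}{n-1}\right)^2}{s^2\left[h\left(\frac{n-2}{n-1}\log s\right)\right]^2}\quad\text{as } s\to+\infty,$$ $$\text{(v)}\quad \lim_{s\to+\infty}\frac{s\,\rho'(s)}{\rho(s)}=-2.$$ (Converse part) Assume that $\rho\in\mathcal B$ satisfies (v), and (iv) for some positive function $h\in C^1(\mathbb R)$ complying with (i), (ii) and $$\int_1^{+\infty}\frac1{h(\tau)}\,d\tau=+\infty.$$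 Let $\psi$ be defined by $$r=\int_0^s[\rho(\tau)]^{\frac12}\,d\tau,\qquad \psi(r)=s(r)\,[\rho(s(r))]^{\frac1{2(n-1)}}\quad\forall r\in(0,+\infty).$$ Then $\psi$ belongs to $\mathcal A$, satisfies $\lim_{r\to+\infty}\psi(r)=+\infty$, and obeys (iii).
   Context: The classes are $$\mathcal A:=\{\psi\in C^\infty((0,+\infty))\cap C^1([0,+\infty)):\ \psi'(0)=1,\ \psi(0)=0,\ \psi>0\text{ in }(0,+\infty)\},$$ $$\mathcal B:=\{\rho\in C^\infty((0,+\infty))\cap C([0,+\infty)):\ \rho(0)=1,\ \lim_{s\to0^+}s\,\rho'(s)=0,\ \rho>0\}.$$ $f(r)\sim g(r)$ means that the ratio tends to $1$. In (ii), $o(1)$ denotes an arbitrary function of $\tau$ tending to $0$ as $\tau\to+\infty$. *)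

theory Defs
  imports "HOL-Analysis.Analysis" "HOL-Library.Landau_Symbols"
begin

text \<open>
  The functions \<psi> and \<rho> are total functions on the reals of which only the values on the closed
  half-line are relevant; their derivatives at 0 are one-sided. For an open set \<open>S\<close>, iterating
  \<^const>\<open>deriv\<close> is harmless below since each iterate at a point of \<open>S\<close> depends only on the germ
  of the function there.
\<close>

definition C_infinity_on :: "(real \<Rightarrow> real) \<Rightarrow> real set \<Rightarrow> bool" where
  "C_infinity_on f S \<longleftrightarrow> (\<forall>k. (deriv ^^ k) f differentiable_on S)"

definition C1_halfline :: "(real \<Rightarrow> real) \<Rightarrow> bool" where
  "C1_halfline f \<longleftrightarrow>
     (\<exists>f'. (\<forall>x\<ge>0. (f has_real_derivative f' x) (at x within {0..})) \<and> continuous_on {0..} f')"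

definition class_A :: "(real \<Rightarrow> real) set" where
  "class_A = {\<psi>. C_infinity_on \<psi> {0<..} \<and> C1_halfline \<psi> \<and>
     (\<psi> has_real_derivative 1) (at 0 within {0..}) \<and> \<psi> 0 = 0 \<and> (\<forall>r>0. \<psi> r > 0)}"

definition class_B :: "(real \<Rightarrow> real) set" where
  "class_B = {\<rho>. C_infinity_on \<rho> {0<..} \<and> continuous_on {0..} \<rho> \<and> \<rho> 0 = 1 \<and>
     ((\<lambda>s. s * deriv \<rho> s) \<longlongrightarrow> 0) (at_right 0) \<and> (\<forall>s\<ge>0. \<rho> s > 0)}"

text \<open>The error term \<open>o(1)\<close> is an arbitrary function \<open>e\<close> tending to 0.\<close>

definition admissible :: "nat \<Rightarrow> (real \<Rightarrow> real) \<Rightarrow> bool" where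
  "admissible n h \<longleftrightarrow>
     (\<forall>\<tau>. h \<tau> > 0) \<and> h C1_differentiable_on UNIV \<and>
     ((\<lambda>\<tau>. deriv h \<tau> / h \<tau>) \<longlongrightarrow> 0) at_top \<and>
     (\<forall>e. (e \<longlongrightarrow> 0) at_top \<longrightarrow>
        ((\<lambda>\<tau>. h (\<tau> + 1 / (real n - 1) * ln (h \<tau>)
                   + 1 / (real n - 1) * ln ((real n - 1) / (real n - 2)) + e \<tau>) / h \<tau>)
           \<longlongrightarrow> 1) at_top)"

definition change_of_variables :: "(real \<Rightarrow> real \<Rightarrow> bool) \<Rightarrow> bool" where
  "change_of_variables P \<longleftrightarrow>
     (\<forall>r>0. \<exists>!s. s > 0 \<and> P r s) \<and> (\<forall>s>0. \<exists>!r. r > 0 \<and> P r s)"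

text \<open>
  Formulas given on the open half-line only are extended to 0 by continuity. If the limit does not
  exist the value at 0 is unspecified, and the extension is not continuous there.
\<close>

definition extend_to_0 :: "(real \<Rightarrow> real) \<Rightarrow> real \<Rightarrow> real" where
  "extend_to_0 f x = (if x = 0 then Lim (at_right 0) f else f x)"

text \<open>
  In the two relations below, \<open>has_integral\<close> includes the convergence of the integral.
\<close>

definition rel_from_\<psi> :: "nat \<Rightarrow> (real \<Rightarrow> real) \<Rightarrow> real \<Rightarrow> real \<Rightarrow> bool" where
  "rel_from_\<psi> n \<psi> r s \<longleftrightarrow>
     ((\<lambda>t. 1 / \<psi> t ^ (n - 1)) has_integral 1 / ((real n - 2) * s ^ (n - 2))) {r..}"

definition weight_of :: "nat \<Rightarrow> (real \<Rightarrow> real) \<Rightarrow> real \<Rightarrow> real" where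
  "weight_of n \<psi> = extend_to_0 (\<lambda>s.
     let r = (THE r. r > 0 \<and> rel_from_\<psi> n \<psi> r s)
     in \<psi> r ^ (2 * (n - 1)) / s ^ (2 * (n - 1)))"

definition rel_from_\<rho> :: "(real \<Rightarrow> real) \<Rightarrow> real \<Rightarrow> real \<Rightarrow> bool" where
  "rel_from_\<rho> \<rho> r s \<longleftrightarrow> ((\<lambda>\<tau>. \<rho> \<tau> powr (1 / 2)) has_integral r) {0..s}"

definition profile_of :: "nat \<Rightarrow> (real \<Rightarrow> real) \<Rightarrow> real \<Rightarrow> real" where
  "profile_of n \<rho> = extend_to_0 (\<lambda>r.
     let s = (THE s. s > 0 \<and> rel_from_\<rho> \<rho> r s)
     in s * \<rho> s powr (1 / (2 * (real n - 1))))"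

definition profile_law :: "(real \<Rightarrow> real) \<Rightarrow> (real \<Rightarrow> real) \<Rightarrow> bool" where
  "profile_law h \<psi> \<longleftrightarrow>
     ((\<lambda>r. deriv (\<lambda>x. ln (\<psi> x)) r / h (ln (\<psi> r))) \<longlongrightarrow> 1) at_top"

definition weight_law :: "nat \<Rightarrow> (real \<Rightarrow> real) \<Rightarrow> (real \<Rightarrow> real) \<Rightarrow> bool" where
  "weight_law n h \<rho> \<longleftrightarrow>
     \<rho> \<sim>[at_top] (\<lambda>s. ((real n - 2) / (real n - 1))\<^sup>2 /
                       (s\<^sup>2 * (h ((real n - 2) / (real n - 1) * ln s))\<^sup>2))"

definition weight_log_slope :: "(real \<Rightarrow> real) \<Rightarrow> bool" where
  "weight_log_slope \<rho> \<longleftrightarrow> ((\<lambda>s. s * deriv \<rho> s / \<rho> s) \<longlongrightarrow> -2) at_top"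

end

theory Submission
  imports Defs
begin

text \<open>
  Write \<open>\<phi> = ln h\<close>, \<open>c = (n - 2)/(n - 1)\<close> and \<open>L = ln \<psi>\<close>. Since \<open>\<phi>' = h'/h\<close> tends to 0, \<open>\<phi>\<close> changes
  by \<open>o(1)\<close> under bounded perturbations of large arguments and is sublinear. Hence the law for the
  profile, \<open>L' \<sim> h(L)\<close>, gives
    \<open>(- \<psi>^-(n-1) / h(L))' \<sim> (n - 1) \<psi>^-(n-1)\<close>,
  because differentiating the factor \<open>1/h(L)\<close> contributes only a relative error of order \<open>h'(L)/h(L)\<close>. By
  l'Hospital the tail \<open>F(r)\<close> of the integral of \<open>\<psi>^-(n-1)\<close> is asymptotic to
  \<open>\<psi>^-(n-1) / ((n - 1) h(L))\<close> (lemma \<open>tail_primitive_asymptotics\<close>), that is,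
  \<open>Q = (n - 2) F \<psi>^(n-1) h(L)\<close> tends to \<open>c\<close>.

  In the direct part \<open>s^-(n-2) = (n - 2) F\<close> and \<open>ds/dr = (s/\<psi>)^(n-1)\<close>, so that
  \<open>s \<surd>\<rho> = Q / h(L)\<close> and \<open>s \<rho>'/\<rho> = 2(n - 1)((L'/h(L)) Q - 1)\<close>. The second formula has the limit \<open>-2\<close>.
  The first is the law for the weight, except that \<open>h\<close> is evaluated at \<open>L\<close> instead of \<open>c ln s\<close>. But
  \<open>c ln s = L + \<phi>(L)/(n - 1) - ln Q/(n - 1)\<close> with a bounded last term, and condition (ii) says that \<open>\<phi>\<close>
  does not notice the shift by \<open>\<phi>(L)/(n - 1)\<close> (lemma \<open>shifted_argument_forward\<close>).

  In the converse part, with \<open>\<sigma> = c ln s\<close>, the law for the weight says that \<open>A = s h(\<sigma>) \<surd>\<rho>\<close> tends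
  to \<open>c\<close>. As \<open>dr/ds = \<surd>\<rho>\<close>, the function \<open>r\<close> grows like the integral of \<open>1/h\<close> up to \<open>\<sigma>\<close>, hence to
  infinity; moreover
  \<open>L'/h(L) = (1 + s \<rho>'/(2(n - 1) \<rho>)) / A \<cdot> h(\<sigma>)/h(L)\<close>, where the first quotient tends to 1. Here
  \<open>L = \<sigma> - \<phi>(\<sigma>)/(n - 1) + O(1)\<close>, so condition (ii) must be used along a shift that starts from the
  unknown \<open>L\<close> and only approximately reaches \<open>\<sigma>\<close> (lemma \<open>shifted_argument_backward\<close>).

  For smoothness, in both parts the original radius as a function of the new one solves an autonomous
  equation \<open>y' = g(y)\<close> with smooth \<open>g\<close>, which makes it smooth without any inverse function theorem
  for higher derivatives. Near the origin everything follows from \<open>\<psi>(r)/r \<rightarrow> 1\<close>,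
  \<open>s/r \<rightarrow> 1\<close> and the limits of \<open>\<psi>'\<close> and \<open>s \<rho>'\<close>.
\<close>

section \<open>Calculus of smooth functions on open sets\<close>

text \<open>
  A family of functions that is closed under differentiation on an open set consists of smooth
  functions. This form avoids ever computing an iterated derivative: to prove smoothness it
  suffices to exhibit a family that contains the derivatives of its members.
\<close>

lemma C_infinity_on_coinduct:
  assumes "open S" and "f \<in> \<F>"
    and closed: "\<And>f. f \<in> \<F> \<Longrightarrow> \<exists>g\<in>\<F>. \<forall>x\<in>S. (f has_real_derivative g x) (at x)"
  shows "C_infinity_on f S"
  unfolding C_infinity_on_def
proof
  fix k
  have "\<exists>g\<in>\<F>. \<forall>x\<in>S. (deriv ^^ k) f x = g x"
  proof (induction k)
    case 0
    show ?case using \<open>f \<in> \<F>\<close> by auto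
  next
    case (Suc k)
    then obtain g where g: "g \<in> \<F>" "\<forall>x\<in>S. (deriv ^^ k) f x = g x" by blast
    obtain g' where g': "g' \<in> \<F>" "\<forall>x\<in>S. (g has_real_derivative g' x) (at x)"
      using closed[OF g(1)] by blast
    have "(deriv ^^ Suc k) f x = g' x" if "x \<in> S" for x
    proof -
      have "\<forall>\<^sub>F y in nhds x. (deriv ^^ k) f y = g y"
        using g(2) \<open>open S\<close> that eventually_nhds by blast
      then have "deriv ((deriv ^^ k) f) x = deriv g x" by (rule deriv_cong_ev) simp
      also have "\<dots> = g' x" using g'(2) that by (auto intro: DERIV_imp_deriv)
      finally show ?thesis by simp
    qed
    then show ?case using g'(1) by blast
  qed
  then obtain g where g: "g \<in> \<F>" "\<forall>x\<in>S. (deriv ^^ k) f x = g x" by blast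
  obtain g' where g': "\<forall>x\<in>S. (g has_real_derivative g' x) (at x)"
    using closed[OF g(1)] by blast
  have "((deriv ^^ k) f has_real_derivative g' x) (at x)" if "x \<in> S" for x
    by (rule has_field_derivative_transform_within_open[OF bspec[OF g' that] \<open>open S\<close> that])
      (simp add: g(2))
  then show "(deriv ^^ k) f differentiable_on S"
    unfolding differentiable_on_def real_differentiable_def
    using has_field_derivative_at_within[of "(deriv ^^ k) f" _ _ S] by blast
qed

lemma C_infinity_on_imp_DERIV:
  assumes "C_infinity_on f S" "open S" "x \<in> S"
  shows "(f has_real_derivative deriv f x) (at x)"
proof -
  have "(deriv ^^ 0) f differentiable_on S"
    using assms(1) unfolding C_infinity_on_def by (rule spec)
  then have "f differentiable_on S" by (simp only: funpow_0)
  then have "f differentiable (at x)"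
    using differentiable_on_eq_differentiable_at[OF assms(2)] assms(3) by blast
  then show ?thesis using DERIV_deriv_iff_real_differentiable by blast
qed

lemma C_infinity_on_deriv: "C_infinity_on f S \<Longrightarrow> C_infinity_on (deriv f) S"
  unfolding C_infinity_on_def
proof
  fix k assume "\<forall>k. (deriv ^^ k) f differentiable_on S"
  then have "(deriv ^^ Suc k) f differentiable_on S" by (rule spec)
  then show "(deriv ^^ k) (deriv f) differentiable_on S" by (simp only: funpow_Suc_right o_apply)
qed

lemma C_infinity_on_primitive:
  assumes "open S" "C_infinity_on g S" "\<And>x. x \<in> S \<Longrightarrow> (f has_real_derivative g x) (at x)"
  shows "C_infinity_on f S"
proof (rule C_infinity_on_coinduct[where \<F> = "insert f {g. C_infinity_on g S}"])
  fix h assume "h \<in> insert f {g. C_infinity_on g S}"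
  then consider "h = f" | "C_infinity_on h S" by blast
  then show "\<exists>g\<in>insert f {g. C_infinity_on g S}. \<forall>x\<in>S. (h has_real_derivative g x) (at x)"
  proof cases
    case 1
    have "\<forall>x\<in>S. (h has_real_derivative g x) (at x)" unfolding 1 using assms(3) by simp
    then show ?thesis by (rule bexI[of _ g]) (simp add: assms(2))
  next
    case 2
    then have "\<forall>x\<in>S. (h has_real_derivative deriv h x) (at x)"
      using C_infinity_on_imp_DERIV[OF _ \<open>open S\<close>] by simp
    then show ?thesis by (rule bexI[of _ "deriv h"]) (simp add: C_infinity_on_deriv 2)
  qed
qed (simp_all add: assms(1))

lemma C_infinity_on_cong:
  assumes "open S" "C_infinity_on g S" "\<And>x. x \<in> S \<Longrightarrow> f x = g x"
  shows "C_infinity_on f S"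
proof (rule C_infinity_on_primitive[OF \<open>open S\<close> C_infinity_on_deriv[OF assms(2)]])
  fix x assume x: "x \<in> S"
  show "(f has_real_derivative deriv g x) (at x)"
    by (rule has_field_derivative_transform_within_open[OF C_infinity_on_imp_DERIV[OF assms(2,1) x] assms(1) x])
      (simp add: assms(3))
qed

lemma C_infinity_on_powr: "C_infinity_on (\<lambda>x. x powr p) {0<..}"
proof (rule C_infinity_on_coinduct[where \<F> = "{\<lambda>x. c * x powr q | c q. True}"])
  fix f :: "real \<Rightarrow> real" assume "f \<in> {\<lambda>x. c * x powr q | c q. True}"
  then obtain c q where f: "f = (\<lambda>x. c * x powr q)" by blast
  have "\<forall>x\<in>{0<..}. (f has_real_derivative c * (q * x powr (q - 1))) (at x)"
    unfolding f using DERIV_cmult[OF has_real_derivative_powr] by simp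
  then have "\<forall>x\<in>{0<..}. (f has_real_derivative (c * q) * x powr (q - 1)) (at x)"
    by (simp only: mult.assoc)
  then show "\<exists>g\<in>{\<lambda>x. c * x powr q | c q. True}. \<forall>x\<in>{0<..}. (f has_real_derivative g x) (at x)"
    by (rule bexI[of _ "\<lambda>x. (c * q) * x powr (q - 1)"]) blast
next
  show "(\<lambda>x. x powr p) \<in> {\<lambda>x. c * x powr q | c q. True}"
    by (rule CollectI, rule exI[of _ 1], rule exI[of _ p]) simp
qed simp

text \<open>
  The family used for chain and product rules: all sums and products of smooth functions on \<open>S\<close>
  and of functions \<open>g \<circ> \<phi>\<close> with \<open>g\<close> smooth on \<open>T\<close>. It is closed under differentiation as soon as
  it contains the derivative of \<open>\<phi>\<close>. A differential equation for \<open>\<phi>\<close> supplies exactly this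
  membership, so smoothness of the solution can be read off from the equation.
\<close>

inductive_set smooth_terms :: "real set \<Rightarrow> real set \<Rightarrow> (real \<Rightarrow> real) \<Rightarrow> (real \<Rightarrow> real) set"
  for S T \<phi> where
  smooth: "C_infinity_on f S \<Longrightarrow> f \<in> smooth_terms S T \<phi>"
| comp: "C_infinity_on g T \<Longrightarrow> (\<lambda>x. g (\<phi> x)) \<in> smooth_terms S T \<phi>"
| add: "f \<in> smooth_terms S T \<phi> \<Longrightarrow> g \<in> smooth_terms S T \<phi> \<Longrightarrow> (\<lambda>x. f x + g x) \<in> smooth_terms S T \<phi>"
| mult: "f \<in> smooth_terms S T \<phi> \<Longrightarrow> g \<in> smooth_terms S T \<phi> \<Longrightarrow> (\<lambda>x. f x * g x) \<in> smooth_terms S T \<phi>"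

lemma C_infinity_on_smooth_terms:
  assumes S: "open S" and T: "open T" and \<phi>: "\<And>x. x \<in> S \<Longrightarrow> \<phi> x \<in> T"
    and \<phi>': "\<phi>' \<in> smooth_terms S T \<phi>" "\<And>x. x \<in> S \<Longrightarrow> (\<phi> has_real_derivative \<phi>' x) (at x)"
    and f: "f \<in> smooth_terms S T \<phi>"
  shows "C_infinity_on f S"
proof (rule C_infinity_on_coinduct[OF S f])
  fix f assume "f \<in> smooth_terms S T \<phi>"
  then show "\<exists>g\<in>smooth_terms S T \<phi>. \<forall>x\<in>S. (f has_real_derivative g x) (at x)"
  proof induction
    case (smooth f)
    then show ?case
      by (intro bexI[of _ "deriv f"] smooth_terms.smooth C_infinity_on_deriv ballI
            C_infinity_on_imp_DERIV[OF _ S])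
  next
    case (comp g)
    have "((\<lambda>x. g (\<phi> x)) has_real_derivative deriv g (\<phi> x) * \<phi>' x) (at x)" if "x \<in> S" for x
      by (rule DERIV_chain2[OF C_infinity_on_imp_DERIV[OF comp T \<phi>[OF that]] \<phi>'(2)[OF that]])
    moreover have "(\<lambda>x. deriv g (\<phi> x) * \<phi>' x) \<in> smooth_terms S T \<phi>"
      by (intro smooth_terms.mult smooth_terms.comp C_infinity_on_deriv comp \<phi>'(1))
    ultimately show ?case by (intro bexI[of _ "\<lambda>x. deriv g (\<phi> x) * \<phi>' x"] ballI)
  next
    case (add f g)
    then obtain f' g' where "f' \<in> smooth_terms S T \<phi>" "g' \<in> smooth_terms S T \<phi>"
      "\<forall>x\<in>S. (f has_real_derivative f' x) (at x)" "\<forall>x\<in>S. (g has_real_derivative g' x) (at x)"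
      by blast
    then show ?case
      by (intro bexI[of _ "\<lambda>x. f' x + g' x"] smooth_terms.add ballI DERIV_add) simp_all
  next
    case (mult f g)
    then obtain f' g' where "f' \<in> smooth_terms S T \<phi>" "g' \<in> smooth_terms S T \<phi>"
      "\<forall>x\<in>S. (f has_real_derivative f' x) (at x)" "\<forall>x\<in>S. (g has_real_derivative g' x) (at x)"
      by blast
    then show ?case
      using mult.hyps
      by (intro bexI[of _ "\<lambda>x. f' x * g x + g' x * f x"] smooth_terms.add
            smooth_terms.mult ballI DERIV_mult) simp_all
  qed
qed

lemma C_infinity_on_const: "open S \<Longrightarrow> C_infinity_on (\<lambda>x. c) S"
proof (rule C_infinity_on_coinduct[where \<F> = "range (\<lambda>c x. c)"])
  fix f :: "real \<Rightarrow> real" assume "f \<in> range (\<lambda>c x. c)"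
  then obtain c where "f = (\<lambda>x. c)" by blast
  then show "\<exists>g\<in>range (\<lambda>c x. c). \<forall>x\<in>S. (f has_real_derivative g x) (at x)"
    by (intro bexI[of _ "\<lambda>x. 0"]) simp_all
qed simp_all

lemma C_infinity_on_id: "open S \<Longrightarrow> C_infinity_on (\<lambda>x. x) S"
  by (rule C_infinity_on_primitive[OF _ C_infinity_on_const[of _ 1]]) simp_all

lemma C_infinity_on_mult:
  assumes "open S" "C_infinity_on f S" "C_infinity_on g S"
  shows "C_infinity_on (\<lambda>x. f x * g x) S"
proof (rule C_infinity_on_smooth_terms[where \<phi> = "\<lambda>x. x" and \<phi>' = "deriv (\<lambda>x. x)" and T = S])
  show "deriv (\<lambda>x. x) \<in> smooth_terms S S (\<lambda>x. x)"
    by (intro smooth_terms.smooth C_infinity_on_deriv C_infinity_on_id assms)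
  show "(\<lambda>x. f x * g x) \<in> smooth_terms S S (\<lambda>x. x)"
    by (intro smooth_terms.smooth smooth_terms.mult assms)
qed (use assms in \<open>simp_all add: C_infinity_on_imp_DERIV[OF C_infinity_on_id]\<close>)

lemma C_infinity_on_compose:
  assumes "open S" "open T" "C_infinity_on f S" "C_infinity_on g T" "\<And>x. x \<in> S \<Longrightarrow> f x \<in> T"
  shows "C_infinity_on (\<lambda>x. g (f x)) S"
  by (rule C_infinity_on_smooth_terms[where \<phi> = f and \<phi>' = "deriv f" and T = T])
    (use assms in \<open>simp_all add: smooth_terms.smooth smooth_terms.comp C_infinity_on_deriv
       C_infinity_on_imp_DERIV[of f S]\<close>)

text \<open>
  Here \<open>\<phi>' = g \<circ> \<phi>\<close> is itself a smooth term. In particular inverse functions of smooth functions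
  with nonvanishing derivative \<open>q'\<close> are covered, with \<open>g = 1/q'\<close>.
\<close>

lemma C_infinity_on_autonomous_ODE:
  assumes "open S" "open T" "C_infinity_on g T" "\<And>x. x \<in> S \<Longrightarrow> \<phi> x \<in> T"
    and ode: "\<And>x. x \<in> S \<Longrightarrow> (\<phi> has_real_derivative g (\<phi> x)) (at x)"
  shows "C_infinity_on \<phi> S"
proof (rule C_infinity_on_primitive[OF \<open>open S\<close> _ ode])
  have g: "(\<lambda>x. g (\<phi> x)) \<in> smooth_terms S T \<phi>"
    by (rule smooth_terms.comp[OF assms(3)])
  show "C_infinity_on (\<lambda>x. g (\<phi> x)) S"
    by (rule C_infinity_on_smooth_terms[OF assms(1,2,4) g ode g])
qed

lemma C_infinity_on_powr_compose:
  assumes "open S" "C_infinity_on f S" "\<And>x. x \<in> S \<Longrightarrow> f x > 0"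
  shows "C_infinity_on (\<lambda>x. f x powr p) S"
  by (rule C_infinity_on_compose[OF assms(1) _ assms(2) C_infinity_on_powr]) (simp_all add: assms(3))

section \<open>Increasing bijections of the half-line\<close>
text \<open>
  Both changes of variables of the theorem have this shape, with the explicit direction \<open>q\<close> given
  by an integral; the lemma collects all that is needed about the inverse \<open>p\<close>.
\<close>

lemma halfline_bijection_inverse:
  fixes q :: "real \<Rightarrow> real"
  assumes q': "\<And>x. x > 0 \<Longrightarrow> (q has_real_derivative q' x) (at x)" "\<And>x. x > 0 \<Longrightarrow> q' x > 0"
    and lim0: "(q \<longlongrightarrow> 0) (at_right 0)" and lim: "filterlim q at_top at_top"
  obtains p where "\<And>x. x > 0 \<Longrightarrow> q x > 0" "\<And>x. x > 0 \<Longrightarrow> p (q x) = x"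
    "\<And>y. y > 0 \<Longrightarrow> p y > 0" "\<And>y. y > 0 \<Longrightarrow> q (p y) = y"
    "\<And>y. y > 0 \<Longrightarrow> (p has_real_derivative 1 / q' (p y)) (at y)"
    "filterlim p (at_right 0) (at_right 0)" "filterlim p at_top at_top"
proof -
  have less: "q x < q y" if "0 < x" "x < y" for x y
  proof (rule DERIV_pos_imp_increasing[OF that(2)])
    fix t assume "x \<le> t"
    then have "t > 0" using that(1) by simp
    then show "\<exists>y. (q has_real_derivative y) (at t) \<and> 0 < y" using q' by blast
  qed
  have cont: "isCont q x" if "x > 0" for x
    using DERIV_isCont[OF q'(1)[OF that]] .
  have pos: "q x > 0" if "x > 0" for x
  proof -
    have "\<forall>\<^sub>F t in at_right 0. q t \<le> q (x / 2)"
      using that unfolding eventually_at_right_field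
      by (intro exI[of _ "x / 2"]) (auto intro!: less_imp_le[OF less])
    then have "0 \<le> q (x / 2)" by (rule tendsto_upperbound[OF lim0]) simp
    also have "\<dots> < q x" using that by (intro less) auto
    finally show ?thesis .
  qed
  have surj: "\<exists>x>0. q x = y" if "y > 0" for y
  proof -
    have "\<forall>\<^sub>F t in at_right 0. q t < y" using order_tendstoD(2)[OF lim0 that] .
    then obtain b where b: "b > 0" "\<And>t. 0 < t \<Longrightarrow> t < b \<Longrightarrow> q t < y"
      unfolding eventually_at_right_field by blast
    have "\<forall>\<^sub>F t in at_top. y \<le> q t" using lim unfolding filterlim_at_top by blast
    then obtain c where c: "\<And>t. t \<ge> c \<Longrightarrow> y \<le> q t" unfolding eventually_at_top_linorder by blast
    have "\<exists>x\<ge>b/2. x \<le> max b c \<and> q x = y"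
    proof (rule IVT)
      show "q (b / 2) \<le> y" using b(1) by (intro less_imp_le[OF b(2)]) simp_all
      show "y \<le> q (max b c)" by (rule c) simp
      show "\<forall>x. b / 2 \<le> x \<and> x \<le> max b c \<longrightarrow> isCont q x"
        using b(1) by (intro allI impI cont) linarith
    qed (use b(1) in simp)
    then obtain x where "b / 2 \<le> x" "q x = y" by blast
    moreover from this have "x > 0" using b(1) by linarith
    ultimately show ?thesis by blast
  qed
  define p where "p = inv_into {0<..} q"
  have p: "p y > 0" "q (p y) = y" if "y > 0" for y
  proof -
    have "y \<in> q ` {0<..}" using surj[OF that] by auto
    then show "p y > 0" "q (p y) = y"
      unfolding p_def using inv_into_into[of y q "{0<..}"] f_inv_into_f[of y q "{0<..}"] by auto
  qed
  have inj: "x = y" if "x > 0" "y > 0" "q x = q y" for x y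
    using less[of x y] less[of y x] that by linarith
  have pq: "p (q x) = x" if "x > 0" for x
    using inj[OF p(1) that p(2)] pos[OF that] by blast
  have p_le: "p y \<le> x" if "y > 0" "x > 0" "y \<le> q x" for x y
    using less[of x "p y"] p[of y] that by linarith
  have p_ge: "x \<le> p y" if "y > 0" "x > 0" "q x \<le> y" for x y
    using less[of "p y" x] p[of y] that by linarith
  have contp: "isCont p y" if "y > 0" for y
  proof -
    have "isCont p (q (p y))"
    proof (rule isCont_inverse_function[where f = q and g = p and d = "p y / 2"])
      show "p y / 2 > 0" using p(1)[OF that] by simp
      fix z assume "\<bar>z - p y\<bar> \<le> p y / 2"
      then have "z > 0" using p(1)[OF that] by arith
      then show "p (q z) = z" "isCont q z" by (auto intro: pq cont)
    qed
    then show ?thesis using p(2)[OF that] by simp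
  qed
  have "(p has_real_derivative inverse (q' (p y))) (at y)" if "y > 0" for y
  proof (rule DERIV_inverse_function[where f = q and g = p and a = 0 and b = "y + 1"])
    show "(q has_real_derivative q' (p y)) (at (p y))" by (rule q'(1)[OF p(1)[OF that]])
    show "q' (p y) \<noteq> 0" using q'(2)[OF p(1)[OF that]] by simp
  qed (use that in \<open>auto intro: p contp\<close>)
  then have p': "(p has_real_derivative 1 / q' (p y)) (at y)" if "y > 0" for y
    using that by (simp add: inverse_eq_divide)
  have top: "filterlim p at_top at_top"
    unfolding filterlim_at_top
  proof
    fix Z
    show "\<forall>\<^sub>F y in at_top. Z \<le> p y"
      using eventually_ge_at_top[of "q (max Z 1)"]
    proof eventually_elim
      case (elim y)
      have Z: "max Z 1 > 0" by simp
      from p_ge[OF less_le_trans[OF pos[OF Z] elim] Z elim] show ?case by simp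
    qed
  qed
  have "(p \<longlongrightarrow> 0) (at_right 0)"
  proof (rule tendsto_sandwich[OF _ _ tendsto_const])
    show "\<forall>\<^sub>F y in at_right 0. 0 \<le> p y"
      using eventually_at_right_less[of 0] by eventually_elim (auto intro: less_imp_le p)
    show "\<forall>\<^sub>F y in at_right 0. p y \<le> p y" by simp
    show "(p \<longlongrightarrow> 0) (at_right 0)"
    proof (rule order_tendstoI)
      fix e :: real assume "e < 0"
      show "\<forall>\<^sub>F y in at_right 0. e < p y"
        using eventually_at_right_less[of 0]
        by eventually_elim (use p(1) \<open>e < 0\<close> in \<open>auto intro: less_trans\<close>)
    next
      fix e :: real assume "0 < e"
      then have e: "e / 2 > 0" by simp
      have "p y < e" if "0 < y" "y < q (e / 2)" for y
        using p_le[OF that(1) e less_imp_le[OF that(2)]] \<open>0 < e\<close> by simp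
      then show "\<forall>\<^sub>F y in at_right 0. p y < e"
        unfolding eventually_at_right_field using pos[OF e] by blast
    qed
  qed
  then have zero: "filterlim p (at_right 0) (at_right 0)"
    unfolding filterlim_at using eventually_at_right_less[of 0] p(1)
    by (auto elim: eventually_mono simp: less_le)
  show ?thesis by (rule that[OF pos pq p p' zero top])
qed

section \<open>Functions whose slope tends to zero\<close>

text \<open>
  For differentiable functions this says that the derivative tends to 0. It is stated with
  difference quotients because only these are used below.
\<close>

definition asymptotically_flat :: "(real \<Rightarrow> real) \<Rightarrow> bool" where
  "asymptotically_flat \<phi> \<longleftrightarrow> (\<forall>\<epsilon>>0. \<exists>T. \<forall>x\<ge>T. \<forall>y\<ge>T. \<bar>\<phi> x - \<phi> y\<bar> \<le> \<epsilon> * \<bar>x - y\<bar>)"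

lemma asymptotically_flatI:
  assumes "\<And>x. (\<phi> has_real_derivative \<phi>' x) (at x)" "(\<phi>' \<longlongrightarrow> 0) at_top"
  shows "asymptotically_flat \<phi>"
  unfolding asymptotically_flat_def
proof (intro allI impI)
  fix \<epsilon> :: real assume "\<epsilon> > 0"
  then have "\<forall>\<^sub>F x in at_top. \<bar>\<phi>' x\<bar> < \<epsilon>"
    using tendstoD[OF assms(2)] by simp
  then obtain T where T: "\<And>x. x \<ge> T \<Longrightarrow> \<bar>\<phi>' x\<bar> < \<epsilon>" unfolding eventually_at_top_linorder by blast
  have "\<bar>\<phi> x - \<phi> y\<bar> \<le> \<epsilon> * \<bar>x - y\<bar>" if "x \<ge> T" "y \<ge> T" for x y
    using field_differentiable_bound[where S = "{T..}" and f = \<phi> and f' = \<phi>' and B = \<epsilon>, of x y]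
      T that has_field_derivative_at_within[OF assms(1)] by (simp add: less_imp_le)
  then show "\<exists>T. \<forall>x\<ge>T. \<forall>y\<ge>T. \<bar>\<phi> x - \<phi> y\<bar> \<le> \<epsilon> * \<bar>x - y\<bar>" by blast
qed

lemma asymptotically_flat_eventually:
  assumes "asymptotically_flat \<phi>" "\<epsilon> > 0" "filterlim u at_top F" "filterlim v at_top F"
  shows "\<forall>\<^sub>F x in F. \<bar>\<phi> (u x) - \<phi> (v x)\<bar> \<le> \<epsilon> * \<bar>u x - v x\<bar>"
proof -
  obtain T where T: "\<And>x y. x \<ge> T \<Longrightarrow> y \<ge> T \<Longrightarrow> \<bar>\<phi> x - \<phi> y\<bar> \<le> \<epsilon> * \<bar>x - y\<bar>"
    using assms(1,2) unfolding asymptotically_flat_def by blast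
  have "\<forall>\<^sub>F x in F. T \<le> u x" "\<forall>\<^sub>F x in F. T \<le> v x"
    using assms(3,4) unfolding filterlim_at_top by blast+
  then show ?thesis by eventually_elim (rule T)
qed

lemma asymptotically_flat_diff_tendsto_0:
  assumes flat: "asymptotically_flat \<phi>" and lim: "filterlim u at_top F" "filterlim v at_top F"
    and bdd: "\<forall>\<^sub>F x in F. \<bar>u x - v x\<bar> \<le> C"
  shows "((\<lambda>x. \<phi> (u x) - \<phi> (v x)) \<longlongrightarrow> 0) F"
proof (rule tendstoI)
  fix e :: real assume "e > 0"
  define \<epsilon> where "\<epsilon> = e / (2 * (\<bar>C\<bar> + 1))"
  have "\<epsilon> > 0" using \<open>e > 0\<close> by (simp add: \<epsilon>_def)
  have "\<epsilon> * \<bar>C\<bar> \<le> \<epsilon> * (\<bar>C\<bar> + 1)" using \<open>\<epsilon> > 0\<close> by simp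
  also have "\<dots> = e / 2" by (simp add: \<epsilon>_def field_simps)
  also have "\<dots> < e" using \<open>e > 0\<close> by simp
  finally have small: "\<epsilon> * \<bar>C\<bar> < e" .
  show "\<forall>\<^sub>F x in F. dist (\<phi> (u x) - \<phi> (v x)) 0 < e"
    using asymptotically_flat_eventually[OF flat \<open>\<epsilon> > 0\<close> lim] bdd
  proof eventually_elim
    case (elim x)
    have "\<epsilon> * \<bar>u x - v x\<bar> \<le> \<epsilon> * \<bar>C\<bar>" using elim(2) \<open>\<epsilon> > 0\<close> by (intro mult_left_mono) auto
    then show ?case using elim(1) small by simp
  qed
qed

lemma asymptotically_flat_linear_at_top:
  assumes flat: "asymptotically_flat \<phi>" and "k > 0"
  shows "filterlim (\<lambda>x. k * x + c * \<phi> x) at_top at_top"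
proof -
  define \<epsilon> where "\<epsilon> = k / (2 * (\<bar>c\<bar> + 1))"
  have "\<epsilon> > 0" using \<open>k > 0\<close> by (simp add: \<epsilon>_def)
  then obtain T where T: "\<And>x y. x \<ge> T \<Longrightarrow> y \<ge> T \<Longrightarrow> \<bar>\<phi> x - \<phi> y\<bar> \<le> \<epsilon> * \<bar>x - y\<bar>"
    using flat unfolding asymptotically_flat_def by blast
  have "\<bar>c\<bar> * \<epsilon> \<le> k / 2" using \<open>k > 0\<close> by (simp add: \<epsilon>_def field_simps)
  have lin: "filterlim (\<lambda>x. (c * \<phi> T + k / 2 * T) + k / 2 * x) at_top at_top"
    using \<open>k > 0\<close>
    by (intro filterlim_tendsto_add_at_top[OF tendsto_const]
        filterlim_tendsto_pos_mult_at_top[OF tendsto_const _ filterlim_ident]) simp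
  show ?thesis
  proof (rule filterlim_at_top_mono[OF lin])
    show "\<forall>\<^sub>F x in at_top. (c * \<phi> T + k / 2 * T) + k / 2 * x \<le> k * x + c * \<phi> x"
      using eventually_ge_at_top[of T]
    proof eventually_elim
      case (elim x)
      have "\<bar>c * (\<phi> x - \<phi> T)\<bar> \<le> \<bar>c\<bar> * (\<epsilon> * \<bar>x - T\<bar>)"
        unfolding abs_mult using T[OF elim order_refl] by (intro mult_left_mono) auto
      also have "\<dots> = (\<bar>c\<bar> * \<epsilon>) * (x - T)" using elim by simp
      also have "\<dots> \<le> k / 2 * (x - T)"
        using \<open>\<bar>c\<bar> * \<epsilon> \<le> k / 2\<close> elim by (intro mult_right_mono) auto
      finally have "- (k / 2 * (x - T)) \<le> c * (\<phi> x - \<phi> T)" by linarith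
      then show ?case by (simp add: field_simps)
    qed
  qed
qed

text \<open>
  The hypothesis on the unperturbed shift \<open>\<tau> \<mapsto> \<tau> + \<phi> \<tau> / a\<close> implies the same for every bounded
  perturbation of it, by flatness.
\<close>

lemma shifted_argument_forward:
  assumes flat: "asymptotically_flat \<phi>" and "a > 0"
    and base: "((\<lambda>\<tau>. \<phi> (\<tau> + \<phi> \<tau> / a) - \<phi> \<tau>) \<longlongrightarrow> 0) at_top"
    and L: "filterlim L at_top F" and bdd: "\<forall>\<^sub>F x in F. \<bar>w x - (L x + \<phi> (L x) / a)\<bar> \<le> C"
  shows "((\<lambda>x. \<phi> (w x) - \<phi> (L x)) \<longlongrightarrow> 0) F"
proof -
  let ?\<Phi> = "\<lambda>x. L x + \<phi> (L x) / a"
  have \<Phi>: "filterlim ?\<Phi> at_top F"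
    using filterlim_compose[OF asymptotically_flat_linear_at_top[OF flat zero_less_one, of "1 / a"] L]
    by simp
  have "filterlim (\<lambda>x. - C + ?\<Phi> x) at_top F"
    by (rule filterlim_tendsto_add_at_top[OF tendsto_const \<Phi>])
  then have w: "filterlim w at_top F"
    by (rule filterlim_at_top_mono) (use bdd in eventually_elim, linarith)
  have "((\<lambda>x. (\<phi> (w x) - \<phi> (?\<Phi> x)) + (\<phi> (?\<Phi> x) - \<phi> (L x))) \<longlongrightarrow> 0 + 0) F"
    by (intro tendsto_add asymptotically_flat_diff_tendsto_0[OF flat w \<Phi> bdd]
        filterlim_compose[OF base L])
  then show ?thesis by simp
qed

text \<open>
  Now \<open>L\<close> is obtained from \<open>\<sigma>\<close> by subtracting \<open>\<phi> \<sigma> / a\<close>, whereas the hypothesis concerns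
  adding \<open>\<phi> L / a\<close> to \<open>L\<close>. Adding it leads to a point \<open>L + \<phi> L / a\<close> whose distance \<open>D\<close> from \<open>\<sigma>\<close> is
  at most \<open>O(1) + \<bar>\<phi> L - \<phi> \<sigma>\<bar> / a\<close>. By the hypothesis \<open>\<phi> L\<close> may be replaced by the value of \<open>\<phi>\<close> at
  that point, and by flatness the last term is then at most \<open>D / 2 + O(1)\<close>. So \<open>D\<close> is bounded, and a
  second use of flatness shows that \<open>\<phi>\<close> has asymptotically the same value at all three points.
\<close>

lemma shifted_argument_backward:
  assumes flat: "asymptotically_flat \<phi>" and "a > 0"
    and base: "((\<lambda>\<tau>. \<phi> (\<tau> + \<phi> \<tau> / a) - \<phi> \<tau>) \<longlongrightarrow> 0) at_top"
    and L: "filterlim L at_top F" and \<sigma>: "filterlim \<sigma> at_top F"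
    and bdd: "\<forall>\<^sub>F x in F. \<bar>L x - (\<sigma> x - \<phi> (\<sigma> x) / a)\<bar> \<le> C"
  shows "((\<lambda>x. \<phi> (L x) - \<phi> (\<sigma> x)) \<longlongrightarrow> 0) F"
proof -
  let ?\<Phi> = "\<lambda>x. L x + \<phi> (L x) / a"
  have \<Phi>: "filterlim ?\<Phi> at_top F"
    using filterlim_compose[OF asymptotically_flat_linear_at_top[OF flat zero_less_one, of "1 / a"] L]
    by simp
  have base': "((\<lambda>x. \<phi> (?\<Phi> x) - \<phi> (L x)) \<longlongrightarrow> 0) F"
    by (rule filterlim_compose[OF base L])
  have "\<forall>\<^sub>F x in F. \<bar>\<phi> (?\<Phi> x) - \<phi> (L x)\<bar> < a"
    using tendstoD[OF base' \<open>a > 0\<close>] by simp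
  moreover have "\<forall>\<^sub>F x in F. \<bar>\<phi> (?\<Phi> x) - \<phi> (\<sigma> x)\<bar> \<le> a / 2 * \<bar>?\<Phi> x - \<sigma> x\<bar>"
    using \<open>a > 0\<close> by (intro asymptotically_flat_eventually[OF flat _ \<Phi> \<sigma>]) simp
  ultimately have "\<forall>\<^sub>F x in F. \<bar>?\<Phi> x - \<sigma> x\<bar> \<le> 2 * (C + 1)"
    using bdd
  proof eventually_elim
    case (elim x)
    let ?D = "?\<Phi> x - \<sigma> x"
    have "?D = (L x - (\<sigma> x - \<phi> (\<sigma> x) / a)) + (\<phi> (L x) - \<phi> (?\<Phi> x)) / a
        + (\<phi> (?\<Phi> x) - \<phi> (\<sigma> x)) / a"
      using \<open>a > 0\<close> by (simp add: field_simps)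
    moreover have "\<bar>D\<bar> \<le> 2 * (C + 1)"
      if "D = X + Y + Z" "\<bar>Y\<bar> \<le> 1" "\<bar>Z\<bar> \<le> \<bar>D\<bar> / 2" "\<bar>X\<bar> \<le> C" for D X Y Z
      using that abs_triangle_ineq[of "X + Y" Z] abs_triangle_ineq[of X Y] by simp
    moreover have "\<bar>(\<phi> (L x) - \<phi> (?\<Phi> x)) / a\<bar> \<le> 1"
      using elim(1) \<open>a > 0\<close> by (simp add: abs_divide abs_minus_commute)
    moreover have "\<bar>(\<phi> (?\<Phi> x) - \<phi> (\<sigma> x)) / a\<bar> \<le> \<bar>?D\<bar> / 2"
      using elim(2) \<open>a > 0\<close> by (simp add: abs_divide divide_le_eq mult.commute)
    ultimately show ?case using elim(3) by blast
  qed
  then have "((\<lambda>x. \<phi> (?\<Phi> x) - \<phi> (\<sigma> x)) \<longlongrightarrow> 0) F"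
    by (rule asymptotically_flat_diff_tendsto_0[OF flat \<Phi> \<sigma>])
  from tendsto_diff[OF this base'] show ?thesis by simp
qed

section \<open>Limits and integrals at infinity\<close>

text \<open>
  The rule of l'Hospital for the indeterminate form \<open>0/0\<close> at infinity, by the substitution
  \<open>x = 1/t\<close>.
\<close>

lemma lhopital_at_top_0:
  fixes f g :: "real \<Rightarrow> real"
  assumes lim: "(f \<longlongrightarrow> 0) at_top" "(g \<longlongrightarrow> 0) at_top"
    and nz: "\<forall>\<^sub>F x in at_top. g x \<noteq> 0" "\<forall>\<^sub>F x in at_top. g' x \<noteq> 0"
    and der: "\<forall>\<^sub>F x in at_top. (f has_real_derivative f' x) (at x)"
      "\<forall>\<^sub>F x in at_top. (g has_real_derivative g' x) (at x)"
    and quot: "filterlim (\<lambda>x. f' x / g' x) F at_top"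
  shows "filterlim (\<lambda>x. f x / g x) F at_top"
proof -
  have inv: "((\<lambda>t. h (inverse t)) has_real_derivative h' (inverse t) * - (inverse t ^ 2)) (at t)"
    if "t > 0" "(h has_real_derivative h' (inverse t)) (at (inverse t))" for h h' :: "real \<Rightarrow> real" and t
    using DERIV_chain2[OF that(2) DERIV_inverse[of t]] that(1) by (simp add: power2_eq_square)
  show ?thesis
    unfolding filterlim_at_top_to_right
  proof (rule lhopital_right)
    show "((\<lambda>t. f (inverse t)) \<longlongrightarrow> 0) (at_right 0)" "((\<lambda>t. g (inverse t)) \<longlongrightarrow> 0) (at_right 0)"
      using lim unfolding filterlim_at_top_to_right .
    show "\<forall>\<^sub>F t in at_right 0. g (inverse t) \<noteq> 0"
      using nz(1) unfolding eventually_at_top_to_right .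
    show "\<forall>\<^sub>F t in at_right 0. g' (inverse t) * - (inverse t ^ 2) \<noteq> 0"
      using nz(2) eventually_at_right_less[of 0] unfolding eventually_at_top_to_right
      by eventually_elim simp
    show "\<forall>\<^sub>F t in at_right 0. ((\<lambda>t. f (inverse t)) has_real_derivative f' (inverse t) * - (inverse t ^ 2)) (at t)"
      using der(1) eventually_at_right_less[of 0] unfolding eventually_at_top_to_right
      by eventually_elim (rule inv)
    show "\<forall>\<^sub>F t in at_right 0. ((\<lambda>t. g (inverse t)) has_real_derivative g' (inverse t) * - (inverse t ^ 2)) (at t)"
      using der(2) eventually_at_right_less[of 0] unfolding eventually_at_top_to_right
      by eventually_elim (rule inv)
    have "\<forall>\<^sub>F t in at_right 0. f' (inverse t) / g' (inverse t)
        = f' (inverse t) * - (inverse t ^ 2) / (g' (inverse t) * - (inverse t ^ 2))"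
      using eventually_at_right_less[of "0::real"] by eventually_elim simp
    then show "filterlim (\<lambda>t. f' (inverse t) * - (inverse t ^ 2) / (g' (inverse t) * - (inverse t ^ 2))) F (at_right 0)"
      using quot unfolding filterlim_at_top_to_right by (rule filterlim_cong[THEN iffD1, OF refl refl])
  qed
qed

lemma bounded_nondecreasing_convergent_at_top:
  fixes f :: "real \<Rightarrow> real"
  assumes mono: "\<And>x y. a \<le> x \<Longrightarrow> x \<le> y \<Longrightarrow> f x \<le> f y" and bdd: "\<And>x. a \<le> x \<Longrightarrow> f x \<le> B"
  obtains l where "(f \<longlongrightarrow> l) at_top" "\<And>x. a \<le> x \<Longrightarrow> f x \<le> l"
proof -
  define l where "l = (SUP x\<in>{a..}. f x)"
  have le: "f x \<le> l" if "a \<le> x" for x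
    unfolding l_def using that bdd by (intro cSUP_upper bdd_aboveI2[where M = B]) auto
  have "(f \<longlongrightarrow> l) at_top"
  proof (rule increasing_tendsto)
    show "\<forall>\<^sub>F x in at_top. f x \<le> l" using eventually_ge_at_top[of a] by eventually_elim (rule le)
    fix y assume "y < l"
    then obtain x0 where x0: "x0 \<ge> a" "y < f x0"
      unfolding l_def using bdd by (subst (asm) less_cSUP_iff) (auto intro: bdd_aboveI2[where M = B])
    show "\<forall>\<^sub>F x in at_top. y < f x"
      using eventually_ge_at_top[of x0] by eventually_elim (use x0 mono in \<open>auto intro: less_le_trans\<close>)
  qed
  then show ?thesis using that le by blast
qed

text \<open>
  The fundamental theorem of calculus on a ray. Since the integrand is nonnegative it can be taken
  from the Lebesgue integral.
\<close>

lemma has_integral_atLeast_of_limit: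
  fixes f F :: "real \<Rightarrow> real"
  assumes der: "\<And>x. a \<le> x \<Longrightarrow> (F has_real_derivative f x) (at x)"
    and nonneg: "\<And>x. a \<le> x \<Longrightarrow> 0 \<le> f x" and cont: "continuous_on {a..} f"
    and lim: "(F \<longlongrightarrow> T) at_top" and le: "F a \<le> T"
  shows "(f has_integral (T - F a)) {a..}"
proof -
  let ?g = "\<lambda>x. if x \<in> {a..} then f x else 0"
  have meas: "?g \<in> borel_measurable borel"
    using borel_measurable_continuous_on_if[OF _ cont continuous_on_const[of _ 0]] by simp
  have "(\<integral>\<^sup>+x. ennreal (?g x) * indicator {a..} x \<partial>lborel) = ennreal (T - F a)"
    by (subst nn_integral_FTC_atLeast[OF meas _ _ lim]) (use der nonneg in auto)
  also have "(\<integral>\<^sup>+x. ennreal (?g x) * indicator {a..} x \<partial>lborel) = (\<integral>\<^sup>+x. ennreal (?g x) \<partial>lborel)"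
    by (intro nn_integral_cong) (auto simp: indicator_def)
  finally have "(?g has_integral (T - F a)) UNIV"
    using nonneg le by (intro nn_integral_has_integral meas) auto
  then show ?thesis by (simp only: has_integral_restrict_UNIV)
qed

lemma primitive_at_top_of_infinite_integral:
  fixes f F :: "real \<Rightarrow> real"
  assumes der: "\<And>x. a \<le> x \<Longrightarrow> (F has_real_derivative f x) (at x)"
    and nonneg: "\<And>x. a \<le> x \<Longrightarrow> 0 \<le> f x" and meas: "f \<in> borel_measurable borel"
    and inf: "(\<integral>\<^sup>+x\<in>{a..}. ennreal (f x) \<partial>lborel) = \<infinity>"
  shows "filterlim F at_top at_top"
proof -
  have mono: "F x \<le> F y" if "a \<le> x" "x \<le> y" for x y
    using that der nonneg by (intro DERIV_nonneg_imp_nondecreasing[of x y F]) (meson order_trans)+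
  have unbdd: "\<exists>x\<ge>a. Z < F x" for Z
  proof (rule ccontr)
    assume "\<not> (\<exists>x\<ge>a. Z < F x)"
    then obtain l where "(F \<longlongrightarrow> l) at_top"
      using bounded_nondecreasing_convergent_at_top[of a F Z] mono by (meson not_less)
    then show False
      using nn_integral_FTC_atLeast[OF meas der nonneg] inf by (metis ennreal_neq_top infinity_ennreal_def)
  qed
  show ?thesis
    unfolding filterlim_at_top
  proof
    fix Z
    obtain x0 where x0: "x0 \<ge> a" "Z < F x0" using unbdd by blast
    show "\<forall>\<^sub>F x in at_top. Z \<le> F x"
      using eventually_ge_at_top[of x0] by eventually_elim (use x0 mono[of x0] in force)
  qed
qed

section \<open>The classes of profiles and of admissible functions\<close>

lemma class_A_DERIV:
  assumes "\<psi> \<in> class_A" "r > 0"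
  shows "(\<psi> has_real_derivative deriv \<psi> r) (at r)"
  by (rule C_infinity_on_imp_DERIV[of \<psi> "{0<..}"]) (use assms in \<open>simp_all add: class_A_def\<close>)

lemma class_A_deriv_at_0:
  assumes "\<psi> \<in> class_A"
  shows "(deriv \<psi> \<longlongrightarrow> 1) (at_right 0)"
proof -
  obtain f' where f': "\<And>x. x \<ge> 0 \<Longrightarrow> (\<psi> has_real_derivative f' x) (at x within {0..})"
    and cont: "continuous_on {0..} f'"
    using assms unfolding class_A_def C1_halfline_def by blast
  have lim: "at (0::real) within {0..} \<noteq> bot"
    by (simp add: at_within_Ici_at_right)
  have "f' 0 = 1"
    using f'[of 0] assms has_field_derivative_unique[OF _ _ lim] unfolding class_A_def by blast
  moreover have "(f' \<longlongrightarrow> f' 0) (at 0 within {0..})"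
    using cont unfolding continuous_on by simp
  ultimately have "(f' \<longlongrightarrow> 1) (at_right 0)" by (simp add: at_within_Ici_at_right)
  moreover have "\<forall>\<^sub>F x in at_right 0. f' x = deriv \<psi> x"
    using eventually_at_right_less[of 0]
  proof eventually_elim
    case (elim x)
    have "at x within {0..} = at x" using elim by (intro at_within_interior) simp
    then have "(\<psi> has_real_derivative f' x) (at x)" using f'[of x] elim by simp
    then show ?case by (rule DERIV_imp_deriv[symmetric])
  qed
  ultimately show ?thesis by (rule Lim_transform_eventually)
qed

lemma class_A_quotient_at_0:
  assumes "\<psi> \<in> class_A"
  shows "((\<lambda>r. \<psi> r / r) \<longlongrightarrow> 1) (at_right 0)"
proof -
  have "(\<psi> has_real_derivative 1) (at 0 within {0..})" "\<psi> 0 = 0"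
    using assms unfolding class_A_def by blast+
  then show ?thesis by (simp add: has_field_derivative_iff at_within_Ici_at_right)
qed

lemma
  assumes "admissible n h"
  shows admissible_pos: "h \<tau> > 0"
    and admissible_DERIV: "(h has_real_derivative deriv h \<tau>) (at \<tau>)"
    and admissible_flat: "asymptotically_flat (\<lambda>\<tau>. ln (h \<tau>))"
proof -
  show pos: "h \<tau> > 0" for \<tau> using assms unfolding admissible_def by blast
  obtain D where "\<And>\<tau>. (h has_vector_derivative D \<tau>) (at \<tau>)"
    using assms unfolding admissible_def C1_differentiable_on_def by blast
  then have "(h has_real_derivative D \<tau>) (at \<tau>)" for \<tau>
    by (simp only: has_real_derivative_iff_has_vector_derivative)
  then show der: "(h has_real_derivative deriv h \<tau>) (at \<tau>)" for \<tau>
    using DERIV_imp_deriv[of h "D \<tau>" \<tau>] by simp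
  have "((\<lambda>\<tau>. ln (h \<tau>)) has_real_derivative deriv h \<tau> / h \<tau>) (at \<tau>)" for \<tau>
    using DERIV_chain2[OF DERIV_ln[OF pos] der, of \<tau>] by (simp add: field_simps)
  moreover have "((\<lambda>\<tau>. deriv h \<tau> / h \<tau>) \<longlongrightarrow> 0) at_top"
    using assms unfolding admissible_def by blast
  ultimately show "asymptotically_flat (\<lambda>\<tau>. ln (h \<tau>))" by (rule asymptotically_flatI)
qed

text \<open>
  This is condition (ii) with error term 0, after removing the constant from the argument: flatness
  of \<open>ln \<circ> h\<close> absorbs all bounded shifts.
\<close>

lemma admissible_shift:
  assumes n: "n \<ge> 3" and adm: "admissible n h"
  shows "((\<lambda>\<tau>. ln (h (\<tau> + ln (h \<tau>) / (real n - 1))) - ln (h \<tau>)) \<longlongrightarrow> 0) at_top"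
proof -
  define k where "k = 1 / (real n - 1) * ln ((real n - 1) / (real n - 2))"
  let ?\<Phi> = "\<lambda>\<tau>. \<tau> + ln (h \<tau>) / (real n - 1)"
  have pos: "h \<tau> > 0" for \<tau> using admissible_pos[OF adm] .
  have "((\<lambda>_. 0) \<longlongrightarrow> 0) at_top \<longrightarrow>
      ((\<lambda>\<tau>. h (\<tau> + 1 / (real n - 1) * ln (h \<tau>)
                   + 1 / (real n - 1) * ln ((real n - 1) / (real n - 2)) + (\<lambda>_. 0) \<tau>) / h \<tau>) \<longlongrightarrow> 1) at_top"
    using adm unfolding admissible_def by blast
  then have "((\<lambda>\<tau>. h (?\<Phi> \<tau> + k) / h \<tau>) \<longlongrightarrow> 1) at_top"
    by (simp add: k_def)
  then have "((\<lambda>\<tau>. ln (h (?\<Phi> \<tau> + k) / h \<tau>)) \<longlongrightarrow> ln 1) at_top"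
    by (rule tendsto_ln) simp
  then have 1: "((\<lambda>\<tau>. ln (h (?\<Phi> \<tau> + k)) - ln (h \<tau>)) \<longlongrightarrow> 0) at_top"
    using pos by (simp add: ln_divide_pos)
  have \<Phi>: "filterlim ?\<Phi> at_top at_top"
    using asymptotically_flat_linear_at_top[OF admissible_flat[OF adm] zero_less_one, of "1 / (real n - 1)"]
    by simp
  have \<Phi>k: "filterlim (\<lambda>\<tau>. ?\<Phi> \<tau> + k) at_top at_top"
    using filterlim_tendsto_add_at_top[OF tendsto_const \<Phi>, of k] by (simp add: add.commute)
  have "\<forall>\<^sub>F \<tau> in at_top. \<bar>(?\<Phi> \<tau> + k) - ?\<Phi> \<tau>\<bar> \<le> \<bar>k\<bar>" by simp
  then have 2: "((\<lambda>\<tau>. ln (h (?\<Phi> \<tau> + k)) - ln (h (?\<Phi> \<tau>))) \<longlongrightarrow> 0) at_top"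
    by (rule asymptotically_flat_diff_tendsto_0[OF admissible_flat[OF adm] \<Phi>k \<Phi>])
  from tendsto_diff[OF 1 2] show ?thesis by simp
qed

section \<open>The tail integral and the radius it defines\<close>

text \<open>
  Compare the primitive \<open>K\<close> of \<open>\<psi>^-a\<close> with \<open>E = \<psi>^-a / h(ln \<psi>)\<close>: one has
  \<open>E' = - \<psi>^-a R\<close> with \<open>R \<rightarrow> a\<close>. As \<open>E\<close> is positive, \<open>K + (2/a) E\<close> being eventually nonincreasing
  bounds \<open>K\<close>; and as \<open>E\<close> tends to 0, l'Hospital gives \<open>(T - K)/E \<rightarrow> 1/a\<close>.
\<close>

lemma tail_primitive_asymptotics:
  fixes \<psi> h K :: "real \<Rightarrow> real"
  assumes "a > 0" and \<psi>: "\<And>r. r > 0 \<Longrightarrow> \<psi> r > 0" "\<And>r. r > 0 \<Longrightarrow> (\<psi> has_real_derivative \<psi>' r) (at r)"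
    "filterlim \<psi> at_top at_top"
    and h: "\<And>\<tau>. h \<tau> > 0" "\<And>\<tau>. (h has_real_derivative h' \<tau>) (at \<tau>)" "((\<lambda>\<tau>. h' \<tau> / h \<tau>) \<longlongrightarrow> 0) at_top"
      "asymptotically_flat (\<lambda>\<tau>. ln (h \<tau>))"
    and law: "((\<lambda>r. \<psi>' r / \<psi> r / h (ln (\<psi> r))) \<longlongrightarrow> 1) at_top"
    and K: "\<And>r. r > 0 \<Longrightarrow> (K has_real_derivative \<psi> r powr - a) (at r)"
  obtains T where "(K \<longlongrightarrow> T) at_top" "\<And>r. r > 0 \<Longrightarrow> K r < T"
    "((\<lambda>r. (T - K r) * (\<psi> r powr a * h (ln (\<psi> r)))) \<longlongrightarrow> 1 / a) at_top"
proof -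
  let ?L = "\<lambda>r. ln (\<psi> r)"
  define E where "E r = \<psi> r powr - a / h (?L r)" for r
  define R where "R r = (\<psi>' r / \<psi> r / h (?L r)) * (a + h' (?L r) / h (?L r))" for r
  have L: "filterlim ?L at_top at_top" by (rule filterlim_compose[OF ln_at_top \<psi>(3)])
  have "((\<lambda>r. (\<psi>' r / \<psi> r / h (?L r)) * (a + h' (?L r) / h (?L r))) \<longlongrightarrow> 1 * (a + 0)) at_top"
    by (intro tendsto_mult law tendsto_add tendsto_const filterlim_compose[OF h(3) L])
  then have R: "(R \<longlongrightarrow> a) at_top" by (simp add: R_def[abs_def])
  have E': "(E has_real_derivative - (\<psi> r powr - a * R r)) (at r)" if "r > 0" for r
  proof -
    have L': "(?L has_real_derivative \<psi>' r / \<psi> r) (at r)"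
      using DERIV_chain2[OF DERIV_ln[OF \<psi>(1)[OF that]] \<psi>(2)[OF that]] by (simp add: field_simps)
    have hL: "((\<lambda>r. h (?L r)) has_real_derivative h' (?L r) * (\<psi>' r / \<psi> r)) (at r)"
      by (rule DERIV_chain2[OF h(2) L'])
    have "\<psi> r powr (- a - 1) = \<psi> r powr - a / \<psi> r"
      using \<psi>(1)[OF that] by (simp add: powr_diff)
    moreover have "h (?L r) \<noteq> 0" using h(1)[of "?L r"] by simp
    ultimately show ?thesis
      unfolding E_def[abs_def] R_def using \<psi>(1)[OF that]
      by (intro DERIV_cong[OF DERIV_divide[OF DERIV_fun_powr[OF \<psi>(2)[OF that] \<psi>(1)[OF that]] hL]])
        (simp_all add: field_simps)
  qed
  have Epos: "E r > 0" if "r > 0" for r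
    using \<psi>(1)[OF that] h(1)[of "?L r"] by (simp add: E_def)
  have E0: "(E \<longlongrightarrow> 0) at_top"
  proof -
    have "filterlim (\<lambda>r. a * ?L r + 1 * ln (h (?L r))) at_top at_top"
      by (rule filterlim_compose[OF asymptotically_flat_linear_at_top[OF h(4) \<open>a > 0\<close>] L])
    then have "((\<lambda>r. exp (- (a * ?L r + 1 * ln (h (?L r))))) \<longlongrightarrow> 0) at_top"
      by (intro filterlim_compose[OF exp_at_bot] filterlim_uminus_at_bot_at_top[THEN filterlim_compose])
    moreover have "\<forall>\<^sub>F r in at_top. exp (- (a * ?L r + 1 * ln (h (?L r)))) = E r"
      using eventually_gt_at_top[of 0]
      by eventually_elim
        (use \<psi>(1) h(1) in \<open>simp add: E_def powr_def exp_diff exp_minus less_imp_neq[symmetric]\<close>)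
    ultimately show ?thesis by (rule Lim_transform_eventually)
  qed
  have "\<forall>\<^sub>F r in at_top. a / 2 < R r" using order_tendstoD(1)[OF R, of "a / 2"] \<open>a > 0\<close> by simp
  then obtain r1 where r1: "\<And>r. r \<ge> r1 \<Longrightarrow> a / 2 < R r" unfolding eventually_at_top_linorder by blast
  define r0 where "r0 = max r1 1"
  have r0: "r0 > 0" "\<And>r. r \<ge> r0 \<Longrightarrow> a / 2 < R r" using r1 by (auto simp: r0_def)
  have mono: "K x < K y" if "0 < x" "x < y" for x y
  proof (rule DERIV_pos_imp_increasing[OF that(2)])
    fix t assume "x \<le> t"
    then have "t > 0" using that(1) by simp
    then show "\<exists>y. (K has_real_derivative y) (at t) \<and> 0 < y" using K[of t] \<psi>(1)[of t] by auto
  qed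
  have bdd: "K r \<le> K r0 + 2 / a * E r0" if "r \<ge> r0" for r
  proof -
    have "K r + 2 / a * E r \<le> K r0 + 2 / a * E r0"
    proof (rule DERIV_nonpos_imp_nonincreasing[OF that])
      fix t assume "r0 \<le> t"
      then have t: "t > 0" using r0(1) by simp
      have "((\<lambda>r. K r + 2 / a * E r) has_real_derivative \<psi> t powr - a + 2 / a * - (\<psi> t powr - a * R t)) (at t)"
        by (intro DERIV_add K DERIV_cmult E' t)
      moreover have "\<psi> t powr - a + 2 / a * - (\<psi> t powr - a * R t) = \<psi> t powr - a * (2 / a * (a / 2 - R t))"
        using \<open>a > 0\<close> by (simp add: field_simps)
      moreover have "\<dots> \<le> 0"
        using r0(2)[OF \<open>r0 \<le> t\<close>] \<open>a > 0\<close> by (intro mult_nonneg_nonpos) auto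
      ultimately show "\<exists>y. ((\<lambda>r. K r + 2 / a * E r) has_real_derivative y) (at t) \<and> y \<le> 0" by metis
    qed
    moreover have "0 < 2 / a * E r" using Epos[of r] that r0(1) \<open>a > 0\<close> by simp
    ultimately show ?thesis by linarith
  qed
  obtain T where T: "(K \<longlongrightarrow> T) at_top" "\<And>r. r0 \<le> r \<Longrightarrow> K r \<le> T"
  proof (rule bounded_nondecreasing_convergent_at_top[of r0 K])
    show "K x \<le> K y" if "r0 \<le> x" "x \<le> y" for x y
      using mono[of x y] that r0(1) by (cases "x = y") auto
  qed (use bdd in blast)+
  have less: "K r < T" if "r > 0" for r
  proof -
    have "K r < K (max r r0 + 1)" using that by (intro mono) auto
    also have "\<dots> \<le> T" by (rule T(2)) simp
    finally show ?thesis .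
  qed
  have "((\<lambda>r. (T - K r) / E r) \<longlongrightarrow> 1 / a) at_top"
  proof (rule lhopital_at_top_0)
    show "((\<lambda>r. T - K r) \<longlongrightarrow> 0) at_top" using tendsto_diff[OF tendsto_const T(1), of T] by simp
    show "(E \<longlongrightarrow> 0) at_top" by (rule E0)
    show "\<forall>\<^sub>F r in at_top. E r \<noteq> 0"
      using eventually_gt_at_top[of 0] by eventually_elim (use Epos in force)
    show nz: "\<forall>\<^sub>F r in at_top. - (\<psi> r powr - a * R r) \<noteq> 0"
      using eventually_ge_at_top[of r0]
    proof eventually_elim
      case (elim r)
      then show ?case using r0(2)[OF elim] \<open>a > 0\<close> \<psi>(1)[of r] r0(1) by simp
    qed
    show "\<forall>\<^sub>F r in at_top. ((\<lambda>r. T - K r) has_real_derivative - (\<psi> r powr - a)) (at r)"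
      using eventually_gt_at_top[of 0]
      by eventually_elim (rule DERIV_cong[OF DERIV_diff[OF DERIV_const K]], simp_all)
    show "\<forall>\<^sub>F r in at_top. (E has_real_derivative - (\<psi> r powr - a * R r)) (at r)"
      using eventually_gt_at_top[of 0] by eventually_elim (rule E')
    have "((\<lambda>r. 1 / R r) \<longlongrightarrow> 1 / a) at_top"
      using \<open>a > 0\<close> by (intro tendsto_divide tendsto_const R) simp
    moreover have "\<forall>\<^sub>F r in at_top. 1 / R r = - (\<psi> r powr - a) / - (\<psi> r powr - a * R r)"
      using nz by eventually_elim simp
    ultimately show "((\<lambda>r. - (\<psi> r powr - a) / - (\<psi> r powr - a * R r)) \<longlongrightarrow> 1 / a) at_top"
      by (rule Lim_transform_eventually)
  qed
  moreover have "\<forall>\<^sub>F r in at_top. (T - K r) / E r = (T - K r) * (\<psi> r powr a * h (ln (\<psi> r)))"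
    using eventually_gt_at_top[of 0]
    by eventually_elim (use \<psi>(1) h(1) in \<open>simp add: E_def powr_minus field_simps less_imp_neq[symmetric]\<close>)
  ultimately have "((\<lambda>r. (T - K r) * (\<psi> r powr a * h (ln (\<psi> r)))) \<longlongrightarrow> 1 / a) at_top"
    by (rule Lim_transform_eventually)
  with T(1) less show ?thesis by (rule that)
qed

text \<open>
  The radius \<open>q r\<close> is the one for which the fundamental solution of flat space of dimension \<open>m + 2\<close>,
  namely \<open>q^-m / m\<close>, has the value \<open>F r\<close>. As \<open>\<psi> r \<sim> r\<close> at the origin, \<open>F\<close> is there asymptotic to
  \<open>r^-m / m\<close> by l'Hospital, whence \<open>q r \<sim> r\<close>.
\<close>

lemma
  fixes m :: real and \<psi> F :: "real \<Rightarrow> real"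
  assumes "m > 0" and \<psi>: "\<And>r. r > 0 \<Longrightarrow> \<psi> r > 0" "((\<lambda>r. \<psi> r / r) \<longlongrightarrow> 1) (at_right 0)"
    and F: "\<And>r. r > 0 \<Longrightarrow> F r > 0" "\<And>r. r > 0 \<Longrightarrow> (F has_real_derivative - (\<psi> r powr - (m + 1))) (at r)"
    and F0: "(F \<longlongrightarrow> 0) at_top"
  defines "q \<equiv> \<lambda>r. (m * F r) powr - (1 / m)"
  shows flat_radius_DERIV: "\<And>r. r > 0 \<Longrightarrow> (q has_real_derivative (q r / \<psi> r) powr (m + 1)) (at r)"
    and flat_radius_quotient_at_0: "((\<lambda>r. q r / r) \<longlongrightarrow> 1) (at_right 0)"
    and flat_radius_at_0: "(q \<longlongrightarrow> 0) (at_right 0)"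
    and flat_radius_at_top: "filterlim q at_top at_top"
proof -
  have mF: "m * F r > 0" if "r > 0" for r using F(1)[OF that] \<open>m > 0\<close> by simp
  show "(q has_real_derivative (q r / \<psi> r) powr (m + 1)) (at r)" if r: "r > 0" for r
  proof -
    have "- (1 / m) * (m + 1) = - (1 / m) - 1" using \<open>m > 0\<close> by (simp add: field_simps)
    then have "q r powr (m + 1) = (m * F r) powr (- (1 / m) - 1)"
      unfolding q_def powr_powr by simp
    then have "(q r / \<psi> r) powr (m + 1) = (m * F r) powr (- (1 / m) - 1) * \<psi> r powr - (m + 1)"
      unfolding powr_minus_divide[of "\<psi> r"]
      using \<psi>(1)[OF r] mF[OF r] by (subst powr_divide) (simp_all add: q_def less_imp_le)
    then show ?thesis
      unfolding q_def using \<open>m > 0\<close>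
      by (intro DERIV_cong[OF DERIV_fun_powr[OF DERIV_cmult[OF F(2)[OF r]] mF[OF r]]]) simp
  qed
  have "((\<lambda>r. F r / r powr - m) \<longlongrightarrow> 1 / m) (at_right 0)"
  proof (rule lhopital_right_at_top)
    have "((\<lambda>r. r powr m) \<longlongrightarrow> 0) (at_right 0)"
      using \<open>m > 0\<close> by (intro tendsto_zero_powrI[where b = m])
        (auto intro: tendsto_ident_at eventually_mono[OF eventually_at_right_less[of 0]] less_imp_le)
    moreover have "\<forall>\<^sub>F r in at_right 0. 0 < (r::real) powr m"
      using eventually_at_right_less[of "0::real"] by eventually_elim simp
    ultimately show "filterlim (\<lambda>r::real. r powr - m) at_top (at_right 0)"
      unfolding powr_minus by (rule filterlim_inverse_at_top)
    show "\<forall>\<^sub>F r in at_right 0. - m * r powr (- m - 1) \<noteq> 0"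
      using eventually_at_right_less[of "0::real"] by eventually_elim (use \<open>m > 0\<close> in simp)
    show "\<forall>\<^sub>F r in at_right 0. (F has_real_derivative - (\<psi> r powr - (m + 1))) (at r)"
      using eventually_at_right_less[of 0] by eventually_elim (rule F(2))
    show "\<forall>\<^sub>F r in at_right 0. ((\<lambda>r. r powr - m) has_real_derivative - m * r powr (- m - 1)) (at r)"
      using eventually_at_right_less[of 0] by eventually_elim (rule has_real_derivative_powr)
    have "((\<lambda>r. (\<psi> r / r) powr - (m + 1) / m) \<longlongrightarrow> 1 powr - (m + 1) / m) (at_right 0)"
      using \<open>m > 0\<close> by (intro tendsto_divide tendsto_powr \<psi>(2) tendsto_const) simp_all
    moreover have "\<forall>\<^sub>F r in at_right 0.
        (\<psi> r / r) powr - (m + 1) / m = - (\<psi> r powr - (m + 1)) / (- m * r powr (- m - 1))"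
      using eventually_at_right_less[of 0]
      by eventually_elim (use \<psi>(1) in \<open>simp add: powr_divide less_imp_le\<close>)
    ultimately have "((\<lambda>r. - (\<psi> r powr - (m + 1)) / (- m * r powr (- m - 1))) \<longlongrightarrow> 1 powr - (m + 1) / m) (at_right 0)"
      by (rule Lim_transform_eventually)
    then show "((\<lambda>r. - (\<psi> r powr - (m + 1)) / (- m * r powr (- m - 1))) \<longlongrightarrow> 1 / m) (at_right 0)"
      by simp
  qed
  then have "((\<lambda>r. (m * (F r / r powr - m)) powr - (1 / m)) \<longlongrightarrow> (m * (1 / m)) powr - (1 / m)) (at_right 0)"
    using \<open>m > 0\<close> by (intro tendsto_powr tendsto_mult tendsto_const) simp_all
  then have lim: "((\<lambda>r. (m * (F r / r powr - m)) powr - (1 / m)) \<longlongrightarrow> 1) (at_right 0)"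
    using \<open>m > 0\<close> by simp
  have "\<forall>\<^sub>F r in at_right 0. (m * (F r / r powr - m)) powr - (1 / m) = q r / r"
    using eventually_at_right_less[of 0]
  proof eventually_elim
    case (elim r)
    have "(m * (F r / r powr - m)) powr - (1 / m) = (m * F r) powr - (1 / m) / (r powr - m) powr - (1 / m)"
      unfolding times_divide_eq_right using elim mF[OF elim]
      by (intro powr_divide)
    also have "(r powr - m) powr - (1 / m) = r"
      unfolding powr_powr using \<open>m > 0\<close> elim by simp
    finally show ?case by (simp add: q_def)
  qed
  with lim show quot: "((\<lambda>r. q r / r) \<longlongrightarrow> 1) (at_right 0)" by (rule Lim_transform_eventually)
  have "((\<lambda>r. q r / r * r) \<longlongrightarrow> 1 * 0) (at_right 0)"
    by (intro tendsto_mult quot tendsto_ident_at)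
  moreover have "\<forall>\<^sub>F r in at_right 0. q r / r * r = q r"
    using eventually_at_right_less[of "0::real"] by eventually_elim simp
  ultimately show "(q \<longlongrightarrow> 0) (at_right 0)"
    using Lim_transform_eventually by fastforce
  have "((\<lambda>r. (m * F r) powr (1 / m)) \<longlongrightarrow> 0) at_top"
  proof (rule tendsto_zero_powrI[OF _ tendsto_const])
    show "((\<lambda>r. m * F r) \<longlongrightarrow> 0) at_top" using tendsto_mult[OF tendsto_const F0, of m] by simp
    show "\<forall>\<^sub>F r in at_top. 0 \<le> m * F r"
      using eventually_gt_at_top[of 0] by eventually_elim (use mF in \<open>auto intro: less_imp_le\<close>)
  qed (use \<open>m > 0\<close> in simp)
  moreover have "\<forall>\<^sub>F r in at_top. 0 < (m * F r) powr (1 / m)"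
    using eventually_gt_at_top[of 0] by eventually_elim (use mF in force)
  ultimately show "filterlim q at_top at_top"
    unfolding q_def powr_minus by (rule filterlim_inverse_at_top)
qed

section \<open>Extension to the origin and changes of variables\<close>

lemma
  assumes f: "\<And>x. x > 0 \<Longrightarrow> f x = g x" and g: "\<And>x. x > 0 \<Longrightarrow> isCont g x" "(g \<longlongrightarrow> l) (at_right 0)"
  shows extend_to_0_at_0: "extend_to_0 f 0 = l"
    and extend_to_0_pos: "\<And>x. x > 0 \<Longrightarrow> extend_to_0 f x = g x"
    and extend_to_0_continuous: "continuous_on {0..} (extend_to_0 f)"
proof -
  have "\<forall>\<^sub>F x in at_right 0. g x = f x"
    using eventually_at_right_less[of 0] by eventually_elim (rule f[symmetric])
  with g(2) have "(f \<longlongrightarrow> l) (at_right 0)" by (rule Lim_transform_eventually)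
  then show at_0: "extend_to_0 f 0 = l" by (simp add: extend_to_0_def tendsto_Lim)
  show pos: "extend_to_0 f x = g x" if "x > 0" for x using that f by (simp add: extend_to_0_def)
  have "\<forall>\<^sub>F x in at_right 0. g x = extend_to_0 f x"
    using eventually_at_right_less[of 0] by eventually_elim (rule pos[symmetric])
  with g(2) have lim: "(extend_to_0 f \<longlongrightarrow> l) (at_right 0)" by (rule Lim_transform_eventually)
  show "continuous_on {0..} (extend_to_0 f)"
    unfolding continuous_on_eq_continuous_within
  proof
    fix x :: real assume x: "x \<in> {0..}"
    show "continuous (at x within {0..}) (extend_to_0 f)"
    proof (cases "x = 0")
      case True
      then show ?thesis using lim at_0 by (simp add: continuous_within at_within_Ici_at_right)
    next
      case False
      then have "x > 0" using x by simp
      then have "\<forall>\<^sub>F y in nhds x. extend_to_0 f y = g y"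
        using eventually_nhds_in_open[of "{0<..}" x] by (auto elim: eventually_mono intro: pos)
      then have "isCont (extend_to_0 f) x" using g(1)[OF \<open>x > 0\<close>] by (simp add: isCont_cong)
      then show ?thesis by (rule continuous_at_imp_continuous_at_within)
    qed
  qed
qed

lemma change_of_variables_of_inverse:
  assumes P: "\<And>r s. r > 0 \<Longrightarrow> s > 0 \<Longrightarrow> P r s \<longleftrightarrow> s = q r"
    and pq: "\<And>r. r > 0 \<Longrightarrow> q r > 0" "\<And>r. r > 0 \<Longrightarrow> p (q r) = r" "\<And>s. s > 0 \<Longrightarrow> p s > 0" "\<And>s. s > 0 \<Longrightarrow> q (p s) = s"
  shows "change_of_variables P" "\<And>s. s > 0 \<Longrightarrow> (THE r. r > 0 \<and> P r s) = p s"
    "\<And>r. r > 0 \<Longrightarrow> (THE s. s > 0 \<and> P r s) = q r"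
proof -
  have 1: "r > 0 \<and> P r s \<longleftrightarrow> r = p s" if "s > 0" for r s using P[of r s] pq that by metis
  have 2: "s > 0 \<and> P r s \<longleftrightarrow> s = q r" if "r > 0" for r s using P[of r s] pq that by metis
  show "change_of_variables P" unfolding change_of_variables_def using 1 2 by simp
  show "(THE r. r > 0 \<and> P r s) = p s" if "s > 0" for s using 1[OF that] by simp
  show "(THE s. s > 0 \<and> P r s) = q r" if "r > 0" for r using 2[OF that] by simp
qed

section \<open>From the profile to the weight\<close>
text \<open>
  With \<open>m = n - 2\<close>, \<open>F\<close> is the tail integral, \<open>q\<close> the map from \<open>r\<close> to \<open>s\<close> and \<open>p\<close> its inverse. All
  statements about the weight \<open>W = Y^(2(m+1))\<close>, where \<open>Y s = \<psi> (p s) / s\<close>, reduce to \<open>p' = Y^(m+1)\<close>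
  near 0 and to the limit of \<open>Q = m F \<psi>^(m+1) h(ln \<psi>)\<close> near infinity; limits in \<open>s\<close> are obtained
  from limits in \<open>r\<close> by composing with \<open>p\<close>.
\<close>

lemma weight_of_profile:
  fixes n :: nat
  assumes n: "n \<ge> 3" and \<psi>: "\<psi> \<in> class_A" and \<psi>_top: "filterlim \<psi> at_top at_top"
    and adm: "admissible n h" and law: "profile_law h \<psi>"
  shows "change_of_variables (rel_from_\<psi> n \<psi>)" "weight_of n \<psi> \<in> class_B"
    "weight_law n h (weight_of n \<psi>)" "weight_log_slope (weight_of n \<psi>)"
proof -
  define m where "m = real n - 2"
  have m: "m > 0" "real n - 1 = m + 1" "real n - 2 = m"
    using n by (auto simp: m_def)
  have pow: "x ^ (n - 1) = x powr (m + 1)" "x ^ (n - 2) = x powr m"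
    "x ^ (2 * (n - 1)) = x powr (2 * (m + 1))" if "x > 0" for x :: real
  proof -
    have "real (n - 1) = m + 1" "real (n - 2) = m" "real (2 * (n - 1)) = 2 * (m + 1)"
      using n by (auto simp: m_def of_nat_diff)
    then show "x ^ (n - 1) = x powr (m + 1)" "x ^ (n - 2) = x powr m"
      "x ^ (2 * (n - 1)) = x powr (2 * (m + 1))"
      using powr_realpow[OF that, of "n - 1"] powr_realpow[OF that, of "n - 2"]
        powr_realpow[OF that, of "2 * (n - 1)"] by simp_all
  qed
  have \<psi>_pos: "\<psi> r > 0" if "r > 0" for r using \<psi> that unfolding class_A_def by blast
  have \<psi>_smooth: "C_infinity_on \<psi> {0<..}" using \<psi> unfolding class_A_def by blast
  note \<psi>_DERIV = class_A_DERIV[OF \<psi>]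
  have h_pos: "h \<tau> > 0" for \<tau> using admissible_pos[OF adm] .
  have h_slope: "((\<lambda>\<tau>. deriv h \<tau> / h \<tau>) \<longlongrightarrow> 0) at_top"
    using adm unfolding admissible_def by blast
  let ?L = "\<lambda>r. ln (\<psi> r)"
  have L_top: "filterlim ?L at_top at_top" by (rule filterlim_compose[OF ln_at_top \<psi>_top])
  have "\<forall>\<^sub>F r in at_top. deriv (\<lambda>x. ln (\<psi> x)) r / h (ln (\<psi> r)) = deriv \<psi> r / \<psi> r / h (?L r)"
    using eventually_gt_at_top[of 0]
  proof eventually_elim
    case (elim r)
    have "((\<lambda>x. ln (\<psi> x)) has_real_derivative deriv \<psi> r / \<psi> r) (at r)"
      using DERIV_chain2[OF DERIV_ln[OF \<psi>_pos[OF elim]] \<psi>_DERIV[OF elim]]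
      by (simp add: field_simps)
    then show ?case by (simp add: DERIV_imp_deriv)
  qed
  with law have law': "((\<lambda>r. deriv \<psi> r / \<psi> r / h (?L r)) \<longlongrightarrow> 1) at_top"
    unfolding profile_law_def by (rule Lim_transform_eventually)

  have \<psi>_powr_smooth: "C_infinity_on (\<lambda>r. \<psi> r powr b) {0<..}" for b
    by (rule C_infinity_on_powr_compose) (simp_all add: \<psi>_smooth \<psi>_pos)
  have \<psi>_powr_cont: "isCont (\<lambda>r. \<psi> r powr b) r" if "r > 0" for b r
    using DERIV_isCont[OF C_infinity_on_imp_DERIV[OF \<psi>_powr_smooth]] that by simp
  \<comment> \<open>Any primitive will do: the correct additive constant is the limit of \<open>K\<close> at infinity,
    whose existence comes out of the asymptotic analysis.\<close>
  have "\<exists>K. \<forall>r. ereal 0 < ereal r \<longrightarrow> ereal r < \<infinity> \<longrightarrow>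
      (K has_vector_derivative \<psi> r powr - (m + 1)) (at r)"
    by (rule einterval_antiderivative) (simp_all add: \<psi>_powr_cont)
  then obtain K where "\<And>r. r > 0 \<Longrightarrow> (K has_vector_derivative \<psi> r powr - (m + 1)) (at r)"
    by auto
  then have K: "(K has_real_derivative \<psi> r powr - (m + 1)) (at r)" if "r > 0" for r
    using that by (simp only: has_real_derivative_iff_has_vector_derivative)
  have "m + 1 > 0" using m by simp
  obtain T where T: "(K \<longlongrightarrow> T) at_top" "\<And>r. r > 0 \<Longrightarrow> K r < T"
    "((\<lambda>r. (T - K r) * (\<psi> r powr (m + 1) * h (ln (\<psi> r)))) \<longlongrightarrow> 1 / (m + 1)) at_top"
    by (rule tail_primitive_asymptotics[OF \<open>m + 1 > 0\<close> \<psi>_pos \<psi>_DERIV \<psi>_top h_pos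
          admissible_DERIV[OF adm] h_slope admissible_flat[OF adm] law' K]) blast+
  define F where "F r = T - K r" for r
  have F_pos: "F r > 0" if "r > 0" for r using T(2)[OF that] by (simp add: F_def)
  have F': "(F has_real_derivative - (\<psi> r powr - (m + 1))) (at r)" if "r > 0" for r
    unfolding F_def[abs_def] by (rule DERIV_cong[OF DERIV_diff[OF DERIV_const K[OF that]]]) simp
  have F0: "(F \<longlongrightarrow> 0) at_top"
    unfolding F_def[abs_def] using tendsto_diff[OF tendsto_const T(1), of T] by simp
  have F_integral: "((\<lambda>t. 1 / \<psi> t ^ (n - 1)) has_integral F r) {r..}" if "r > 0" for r
  proof -
    have "((\<lambda>t. \<psi> t powr - (m + 1)) has_integral (T - K r)) {r..}"
    proof (rule has_integral_atLeast_of_limit[OF K _ _ T(1)])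
      show "continuous_on {r..} (\<lambda>t. \<psi> t powr - (m + 1))"
        using that \<psi>_powr_cont by (intro continuous_at_imp_continuous_on ballI) simp
    qed (use that T(2)[OF that] in simp_all)
    then show ?thesis
      unfolding F_def
      by (rule has_integral_eq[rotated])
        (use that \<psi>_pos pow(1) in \<open>simp add: powr_minus_divide del: minus_add_distrib\<close>)
  qed

  define q where "q = (\<lambda>r. (m * F r) powr - (1 / m))"
  have q': "(q has_real_derivative (q r / \<psi> r) powr (m + 1)) (at r)" if "r > 0" for r
    unfolding q_def
    by (rule flat_radius_DERIV[OF m(1) \<psi>_pos class_A_quotient_at_0[OF \<psi>] F_pos F' F0 that])
  have q_quotient: "((\<lambda>r. q r / r) \<longlongrightarrow> 1) (at_right 0)"
    unfolding q_def
    by (rule flat_radius_quotient_at_0[OF m(1) \<psi>_pos class_A_quotient_at_0[OF \<psi>] F_pos F' F0])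
  have q_0: "(q \<longlongrightarrow> 0) (at_right 0)"
    unfolding q_def
    by (rule flat_radius_at_0[OF m(1) \<psi>_pos class_A_quotient_at_0[OF \<psi>] F_pos F' F0])
  have q_top: "filterlim q at_top at_top"
    unfolding q_def
    by (rule flat_radius_at_top[OF m(1) \<psi>_pos class_A_quotient_at_0[OF \<psi>] F_pos F' F0])
  have q'_pos: "(q r / \<psi> r) powr (m + 1) > 0" if "r > 0" for r
    using \<psi>_pos[OF that] F_pos[OF that] m(1) by (simp add: q_def)
  obtain p where q_pos: "\<And>r. r > 0 \<Longrightarrow> q r > 0" and pq: "\<And>r. r > 0 \<Longrightarrow> p (q r) = r"
    and p_pos: "\<And>s. s > 0 \<Longrightarrow> p s > 0" and qp: "\<And>s. s > 0 \<Longrightarrow> q (p s) = s"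
    and p'_raw: "\<And>s. s > 0 \<Longrightarrow> (p has_real_derivative 1 / (q (p s) / \<psi> (p s)) powr (m + 1)) (at s)"
    and p0: "filterlim p (at_right 0) (at_right 0)" and p_top: "filterlim p at_top at_top"
    by (rule halfline_bijection_inverse[OF q' q'_pos q_0 q_top]) blast+
  have q_powr: "q r powr - m = m * F r" if "r > 0" for r
    using m(1) F_pos[OF that] unfolding q_def powr_powr by simp
  have rel: "rel_from_\<psi> n \<psi> r s \<longleftrightarrow> s = q r" if "r > 0" "s > 0" for r s
  proof -
    have "rel_from_\<psi> n \<psi> r s \<longleftrightarrow> F r = 1 / ((real n - 2) * s ^ (n - 2))"
      unfolding rel_from_\<psi>_def using F_integral[OF that(1)] has_integral_unique by metis
    also have "\<dots> \<longleftrightarrow> s powr - m = q r powr - m"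
      unfolding q_powr[OF that(1)] using m pow(2)[OF that(2)] that by (auto simp: powr_minus field_simps)
    also have "\<dots> \<longleftrightarrow> s = q r"
      using m(1) that(2) q_pos[OF that(1)] powr_less_mono2[of m s "q r"] powr_less_mono2[of m "q r" s]
      by (cases s "q r" rule: linorder_cases) (simp_all add: powr_minus)
    finally show ?thesis .
  qed
  show "change_of_variables (rel_from_\<psi> n \<psi>)"
    by (rule change_of_variables_of_inverse(1)[where q = q and p = p]) (fact rel q_pos pq p_pos qp)+
  have the_r: "(THE r. r > 0 \<and> rel_from_\<psi> n \<psi> r s) = p s" if "s > 0" for s
    by (rule change_of_variables_of_inverse(2)[where q = q and p = p]) (fact rel q_pos pq p_pos qp that)+

  define Y where "Y s = \<psi> (p s) * s powr - 1" for s
  define W where "W s = Y s powr (2 * (m + 1))" for s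
  have Y_eq: "Y s = \<psi> (p s) / s" if "s > 0" for s using that by (simp add: Y_def powr_minus_divide)
  have Y_pos: "Y s > 0" if "s > 0" for s using that \<psi>_pos[OF p_pos[OF that]] by (simp add: Y_def)
  have p': "(p has_real_derivative Y s powr (m + 1)) (at s)" if "s > 0" for s
    using p'_raw[OF that] \<psi>_pos[OF p_pos[OF that]] that
    by (simp add: qp Y_eq powr_divide less_imp_le)
  have F_smooth: "C_infinity_on (\<lambda>r. m * F r) {0<..}"
  proof (rule C_infinity_on_primitive)
    show "C_infinity_on (\<lambda>r. - m * \<psi> r powr - (m + 1)) {0<..}"
      by (intro C_infinity_on_mult C_infinity_on_const \<psi>_powr_smooth) simp_all
    show "((\<lambda>r. m * F r) has_real_derivative - m * \<psi> r powr - (m + 1)) (at r)" if "r \<in> {0<..}" for r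
      using that by (intro DERIV_cong[OF DERIV_cmult[OF F']]) simp_all
  qed simp
  have q_smooth: "C_infinity_on q {0<..}"
    unfolding q_def by (rule C_infinity_on_powr_compose) (use m F_pos F_smooth in simp_all)
  have p_smooth: "C_infinity_on p {0<..}"
  proof (rule C_infinity_on_autonomous_ODE[where T = "{0<..}" and g = "\<lambda>r. (\<psi> r * q r powr - 1) powr (m + 1)"])
    have "\<psi> r * q r powr - 1 > 0" if "r > 0" for r
      using \<psi>_pos[OF that] q_pos[OF that] by (intro mult_pos_pos) simp_all
    then show "C_infinity_on (\<lambda>r. (\<psi> r * q r powr - 1) powr (m + 1)) {0<..}"
      by (intro C_infinity_on_powr_compose C_infinity_on_mult)
        (use \<psi>_smooth q_smooth \<psi>_pos q_pos in simp_all)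
    show "(p has_real_derivative (\<psi> (p s) * q (p s) powr - 1) powr (m + 1)) (at s)" if "s \<in> {0<..}" for s
      using p'[of s] that by (simp add: qp Y_def)
  qed (use p_pos in simp_all)
  have Y_smooth: "C_infinity_on Y {0<..}"
    unfolding Y_def[abs_def]
    by (intro C_infinity_on_mult C_infinity_on_powr C_infinity_on_compose[OF _ _ p_smooth \<psi>_smooth])
      (use p_pos in simp_all)
  have W_smooth: "C_infinity_on W {0<..}"
    unfolding W_def[abs_def] by (intro C_infinity_on_powr_compose Y_smooth) (use Y_pos in simp_all)
  have Y_0: "(Y \<longlongrightarrow> 1) (at_right 0)"
  proof -
    have "((\<lambda>s. (\<psi> (p s) / p s) / (q (p s) / p s)) \<longlongrightarrow> 1 / 1) (at_right 0)"
      by (intro tendsto_divide filterlim_compose[OF class_A_quotient_at_0[OF \<psi>] p0]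
          filterlim_compose[OF q_quotient p0]) simp
    moreover have "\<forall>\<^sub>F s in at_right 0. (\<psi> (p s) / p s) / (q (p s) / p s) = Y s"
      using eventually_at_right_less[of 0]
      by eventually_elim (use p_pos in \<open>force simp: qp Y_eq\<close>)
    ultimately have "(Y \<longlongrightarrow> 1 / 1) (at_right 0)" by (rule Lim_transform_eventually)
    then show ?thesis by simp
  qed
  have "((\<lambda>s. Y s powr (2 * (m + 1))) \<longlongrightarrow> 1 powr (2 * (m + 1))) (at_right 0)"
    by (intro tendsto_powr Y_0 tendsto_const) simp
  then have W_0: "(W \<longlongrightarrow> 1) (at_right 0)" by (simp add: W_def[abs_def])
  have W_pos: "W s > 0" if "s > 0" for s using Y_pos[OF that] by (simp add: W_def)
  have W_cont: "isCont W s" if "s > 0" for s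
    using DERIV_isCont[OF C_infinity_on_imp_DERIV[OF W_smooth]] that by simp
  have weight_eq: "(let r = THE r. r > 0 \<and> rel_from_\<psi> n \<psi> r s
      in \<psi> r ^ (2 * (n - 1)) / s ^ (2 * (n - 1))) = W s" if "s > 0" for s
    unfolding the_r[OF that] Let_def W_def Y_eq[OF that] pow(3)[OF that] pow(3)[OF \<psi>_pos[OF p_pos[OF that]]]
    by (rule powr_divide[symmetric])
  have weight_0: "weight_of n \<psi> 0 = 1"
    unfolding weight_of_def by (rule extend_to_0_at_0[OF weight_eq W_cont W_0])
  have weight: "weight_of n \<psi> s = W s" if "s > 0" for s
    unfolding weight_of_def by (rule extend_to_0_pos[OF weight_eq W_cont W_0 that])
  have weight_cont: "continuous_on {0..} (weight_of n \<psi>)"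
    unfolding weight_of_def by (rule extend_to_0_continuous[OF weight_eq W_cont W_0])
  have weight_smooth: "C_infinity_on (weight_of n \<psi>) {0<..}"
    by (rule C_infinity_on_cong[OF _ W_smooth]) (simp_all add: weight)

  \<comment> \<open>This is \<open>s W'/W\<close>. It is small near 0 because \<open>\<psi>'\<close> and \<open>Y\<close> tend to 1 there.\<close>
  define slope where "slope s = 2 * (m + 1) * (deriv \<psi> (p s) * Y s powr m - 1)" for s
  have W': "(W has_real_derivative slope s * W s / s) (at s)" if "s > 0" for s
  proof -
    note pos = that \<psi>_pos[OF p_pos[OF that]] Y_pos[OF that]
    define e where "e = deriv \<psi> (p s) * Y s powr m - 1"
    have Y': "(Y has_real_derivative e * Y s / s) (at s)"
      unfolding e_def Y_def[abs_def]
    proof (rule DERIV_cong[OF DERIV_mult[OF DERIV_chain2[OF \<psi>_DERIV[OF p_pos[OF that]] p'[OF that]]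
          has_real_derivative_powr[OF that]]])
      have "s powr (- 1 - 1) = 1 / (s * s)" using that by (simp add: powr_diff powr_minus_divide power2_eq_square)
      moreover have "Y s powr (m + 1) = Y s powr m * Y s" using pos by (simp add: powr_add)
      ultimately show "deriv \<psi> (p s) * Y s powr (m + 1) * s powr - 1 + - 1 * s powr (- 1 - 1) * \<psi> (p s)
        = (deriv \<psi> (p s) * (\<psi> (p s) * s powr - 1) powr m - 1) * (\<psi> (p s) * s powr - 1) / s"
        unfolding Y_def[symmetric] using pos by (simp add: Y_eq powr_minus_divide field_simps)
    qed
    have "Y s powr (2 * (m + 1) - of_nat 1) = W s / Y s"
      using powr_diff[of "Y s" "2 * (m + 1)" 1] pos by (simp add: W_def)
    then have "2 * (m + 1) * Y s powr (2 * (m + 1) - of_nat 1) * (e * Y s / s) = slope s * W s / s"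
      unfolding slope_def e_def[symmetric] using pos by simp
    from DERIV_cong[OF DERIV_fun_powr[OF Y' pos(3)] this] show ?thesis
      by (simp only: W_def[abs_def])
  qed
  have weight': "deriv (weight_of n \<psi>) s = slope s * weight_of n \<psi> s / s" if "s > 0" for s
  proof -
    have "(weight_of n \<psi> has_real_derivative slope s * W s / s) (at s)"
      by (rule has_field_derivative_transform_within_open[OF W'[OF that], of "{0<..}"])
        (use that in \<open>simp_all add: weight\<close>)
    then show ?thesis using that by (simp add: DERIV_imp_deriv weight)
  qed
  have slope_0: "(slope \<longlongrightarrow> 0) (at_right 0)"
  proof -
    have "((\<lambda>s. 2 * (m + 1) * (deriv \<psi> (p s) * Y s powr m - 1)) \<longlongrightarrow> 2 * (m + 1) * (1 * 1 powr m - 1)) (at_right 0)"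
      by (intro tendsto_intros tendsto_powr filterlim_compose[OF class_A_deriv_at_0[OF \<psi>] p0] Y_0) simp
    then show ?thesis by (simp add: slope_def[abs_def])
  qed
  show "weight_of n \<psi> \<in> class_B"
    unfolding class_B_def
  proof (intro CollectI conjI allI impI)
    have "((\<lambda>s. slope s * W s) \<longlongrightarrow> 0 * 1) (at_right 0)" by (intro tendsto_mult slope_0 W_0)
    moreover have "\<forall>\<^sub>F s in at_right 0. slope s * W s = s * deriv (weight_of n \<psi>) s"
      using eventually_at_right_less[of 0] by eventually_elim (simp add: weight' weight)
    ultimately show "((\<lambda>s. s * deriv (weight_of n \<psi>) s) \<longlongrightarrow> 0) (at_right 0)"
      using Lim_transform_eventually by fastforce
    show "weight_of n \<psi> s > 0" if "s \<ge> 0" for s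
      using that W_pos[of s] by (cases "s = 0") (simp_all add: weight_0 weight)
  qed (fact weight_smooth weight_cont weight_0)+

  define Q where "Q r = m * F r * \<psi> r powr (m + 1) * h (?L r)" for r
  have Q_pos: "Q r > 0" if "r > 0" for r
    using F_pos[OF that] \<psi>_pos[OF that] h_pos[of "?L r"] m(1) by (simp add: Q_def)
  have "((\<lambda>r. m * ((T - K r) * (\<psi> r powr (m + 1) * h (?L r)))) \<longlongrightarrow> m * (1 / (m + 1))) at_top"
    by (intro tendsto_mult tendsto_const T(3))
  then have Q: "(Q \<longlongrightarrow> m / (m + 1)) at_top"
    by (simp add: Q_def[abs_def] F_def mult.assoc)
  \<comment> \<open>The left-hand side is \<open>s\<close> times the square root of the weight.\<close>
  have Y_Q: "Y s powr (m + 1) * s = Q (p s) / h (?L (p s))" if "s > 0" for s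
  proof -
    have "Y s powr (m + 1) * s = \<psi> (p s) powr (m + 1) * s powr - m"
      using that \<psi>_pos[OF p_pos[OF that]]
      by (simp add: Y_eq powr_divide powr_add powr_minus field_simps)
    also have "s powr - m = m * F (p s)" using q_powr[OF p_pos[OF that]] qp[OF that] by simp
    finally show ?thesis using h_pos[of "?L (p s)"] by (simp add: Q_def)
  qed
  show "weight_log_slope (weight_of n \<psi>)"
  proof -
    have "((\<lambda>r. 2 * (m + 1) * (deriv \<psi> r / \<psi> r / h (?L r) * Q r - 1)) \<longlongrightarrow> 2 * (m + 1) * (1 * (m / (m + 1)) - 1)) at_top"
      by (intro tendsto_intros law' Q)
    also have "2 * (m + 1) * (1 * (m / (m + 1)) - 1) = - 2" using m(1) by (simp add: field_simps)
    finally have "((\<lambda>s. 2 * (m + 1) * (deriv \<psi> (p s) / \<psi> (p s) / h (?L (p s)) * Q (p s) - 1)) \<longlongrightarrow> - 2) at_top"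
      by (rule filterlim_compose[OF _ p_top])
    moreover have "\<forall>\<^sub>F s in at_top. 2 * (m + 1) * (deriv \<psi> (p s) / \<psi> (p s) / h (?L (p s)) * Q (p s) - 1)
        = s * deriv (weight_of n \<psi>) s / weight_of n \<psi> s"
      using eventually_gt_at_top[of 0]
    proof eventually_elim
      case (elim s)
      note pos = elim \<psi>_pos[OF p_pos[OF elim]] Y_pos[OF elim] W_pos[OF elim]
      have "deriv \<psi> (p s) / \<psi> (p s) / h (?L (p s)) * Q (p s)
          = deriv \<psi> (p s) / \<psi> (p s) * (Y s powr (m + 1) * s)"
        unfolding Y_Q[OF elim] by simp
      also have "\<dots> = deriv \<psi> (p s) * Y s powr m"
        using pos by (simp add: powr_add Y_eq)
      finally show ?case using pos by (simp add: weight' slope_def weight)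
    qed
    ultimately show ?thesis unfolding weight_log_slope_def by (rule Lim_transform_eventually)
  qed

  let ?c = "m / (m + 1)"
  have "((\<lambda>r. ln (h (?c * ln (q r))) - ln (h (?L r))) \<longlongrightarrow> 0) at_top"
  proof (rule shifted_argument_forward[OF admissible_flat[OF adm] \<open>m + 1 > 0\<close> _ L_top])
    show "((\<lambda>\<tau>. ln (h (\<tau> + ln (h \<tau>) / (m + 1))) - ln (h \<tau>)) \<longlongrightarrow> 0) at_top"
      using admissible_shift[OF n adm] unfolding m(2) .
    have "((\<lambda>r. \<bar>ln (Q r) / (m + 1)\<bar>) \<longlongrightarrow> \<bar>ln ?c / (m + 1)\<bar>) at_top"
      using m by (intro tendsto_intros Q) simp_all
    then have "\<forall>\<^sub>F r in at_top. \<bar>ln (Q r) / (m + 1)\<bar> < \<bar>ln ?c / (m + 1)\<bar> + 1"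
      by (rule order_tendstoD) simp
    then show "\<forall>\<^sub>F r in at_top. \<bar>?c * ln (q r) - (?L r + ln (h (?L r)) / (m + 1))\<bar> \<le> \<bar>ln ?c / (m + 1)\<bar> + 1"
      using eventually_gt_at_top[of 0]
    proof eventually_elim
      case (elim r)
      note pos = F_pos[OF elim(2)] \<psi>_pos[OF elim(2)] h_pos[of "?L r"] m(1)
      have "ln (Q r) = ln (m * F r) + (m + 1) * ?L r + ln (h (?L r))"
        using pos by (simp add: Q_def ln_mult_pos ln_powr)
      moreover have "?c * ln (q r) = - (ln (m * F r) / (m + 1))"
        using pos by (simp add: q_def ln_powr)
      moreover have "- (x / (m + 1)) - (l + y / (m + 1)) = - ((x + (m + 1) * l + y) / (m + 1))" for x l y
        using \<open>m + 1 > 0\<close> by (simp add: add_divide_distrib)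
      ultimately have "?c * ln (q r) - (?L r + ln (h (?L r)) / (m + 1)) = - (ln (Q r) / (m + 1))"
        by simp
      then show ?case using elim(1) by simp
    qed
  qed
  then have "((\<lambda>r. (Q r / ?c * exp (ln (h (?c * ln (q r))) - ln (h (?L r))))\<^sup>2) \<longlongrightarrow> (?c / ?c * exp 0)\<^sup>2) at_top"
    using m by (intro tendsto_intros Q) simp_all
  also have "(?c / ?c * exp 0)\<^sup>2 = 1" using m by simp
  finally have "((\<lambda>s. (Q (p s) / ?c * exp (ln (h (?c * ln (q (p s)))) - ln (h (?L (p s)))))\<^sup>2) \<longlongrightarrow> 1) at_top"
    by (rule filterlim_compose[OF _ p_top])
  moreover have "\<forall>\<^sub>F s in at_top. (Q (p s) / ?c * exp (ln (h (?c * ln (q (p s)))) - ln (h (?L (p s)))))\<^sup>2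
      = weight_of n \<psi> s / (?c\<^sup>2 / (s\<^sup>2 * (h (?c * ln s))\<^sup>2))"
    using eventually_gt_at_top[of 0]
  proof eventually_elim
    case (elim s)
    note pos = elim Y_pos[OF elim] h_pos[of "?L (p s)"] h_pos[of "?c * ln s"]
    have "W s = (Y s powr (m + 1))\<^sup>2"
      by (simp only: W_def mult_2 powr_add power2_eq_square)
    then have "W s / (?c\<^sup>2 / (s\<^sup>2 * (h (?c * ln s))\<^sup>2)) = ((Y s powr (m + 1) * s) * h (?c * ln s) / ?c)\<^sup>2"
      by (simp add: power_mult_distrib power_divide)
    also have "\<dots> = (Q (p s) / ?c * (h (?c * ln s) / h (?L (p s))))\<^sup>2"
      unfolding Y_Q[OF elim] by (simp add: ac_simps)
    finally show ?case using pos by (simp add: exp_diff qp weight)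
  qed
  ultimately have "((\<lambda>s. weight_of n \<psi> s / (?c\<^sup>2 / (s\<^sup>2 * (h (?c * ln s))\<^sup>2))) \<longlongrightarrow> 1) at_top"
    by (rule Lim_transform_eventually)
  then show "weight_law n h (weight_of n \<psi>)"
    unfolding weight_law_def m(2,3) by (rule asymp_equivI')
qed

section \<open>From the weight to the profile\<close>
text \<open>
  With \<open>m = n - 2\<close>, \<open>R\<close> is the map from \<open>s\<close> to \<open>r\<close> and \<open>p\<close> its inverse. The profile is \<open>Z \<circ> p\<close> and
  its derivative is \<open>D \<circ> p\<close>, both with explicit functions \<open>Z\<close> and \<open>D\<close> of \<open>s\<close>, so limits are again
  computed in one variable and transported by \<open>p\<close>.
\<close>

lemma profile_of_weight:
  fixes n :: nat
  assumes n: "n \<ge> 3" and \<rho>: "\<rho> \<in> class_B" and log_slope: "weight_log_slope \<rho>"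
    and adm: "admissible n h" and law: "weight_law n h \<rho>"
    and inf: "(\<integral>\<^sup>+\<tau>\<in>{1..}. ennreal (1 / h \<tau>) \<partial>lborel) = \<infinity>"
  shows "change_of_variables (rel_from_\<rho> \<rho>)" "profile_of n \<rho> \<in> class_A"
    "filterlim (profile_of n \<rho>) at_top at_top" "profile_law h (profile_of n \<rho>)"
proof -
  define m where "m = real n - 2"
  define b where "b = 1 / (2 * (m + 1))"
  let ?c = "m / (m + 1)"
  have m: "m > 0" "real n - 1 = m + 1" "real n - 2 = m" "m + 1 > 0" "?c > 0"
    using n by (auto simp: m_def)
  have \<rho>_pos: "\<rho> s > 0" if "s \<ge> 0" for s using \<rho> that unfolding class_B_def by blast
  have \<rho>_smooth: "C_infinity_on \<rho> {0<..}" and \<rho>_cont: "continuous_on {0..} \<rho>" and \<rho>_0: "\<rho> 0 = 1"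
    and \<rho>'_0: "((\<lambda>s. s * deriv \<rho> s) \<longlongrightarrow> 0) (at_right 0)"
    using \<rho> unfolding class_B_def by blast+
  have \<rho>_DERIV: "(\<rho> has_real_derivative deriv \<rho> s) (at s)" if "s > 0" for s
    by (rule C_infinity_on_imp_DERIV[OF \<rho>_smooth]) (use that in simp_all)
  have "(\<rho> \<longlongrightarrow> \<rho> 0) (at 0 within {0..})" using \<rho>_cont unfolding continuous_on by simp
  then have \<rho>_lim: "(\<rho> \<longlongrightarrow> 1) (at_right 0)" by (simp add: \<rho>_0 at_within_Ici_at_right)
  have h_pos: "h \<tau> > 0" for \<tau> using admissible_pos[OF adm] .
  note flat = admissible_flat[OF adm]

  let ?g = "\<lambda>s. \<rho> s powr (1 / 2)"
  have g_cont: "continuous_on {0..s} ?g" for s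
  proof (intro continuous_on_powr continuous_on_const ballI)
    show "continuous_on {0..s} \<rho>" by (rule continuous_on_subset[OF \<rho>_cont]) simp
    show "\<rho> t \<noteq> 0" if "t \<in> {0..s}" for t using \<rho>_pos[of t] that by simp
  qed
  have g_pos: "?g s > 0" if "s > 0" for s using \<rho>_pos[of s] that by simp
  define R where "R s = integral {0..s} ?g" for s
  have R_integral: "(?g has_integral R s) {0..s}" for s
    unfolding R_def by (rule integrable_integral[OF integrable_continuous_real[OF g_cont]])
  have R': "(R has_real_derivative ?g s) (at s)" if "s > 0" for s
  proof -
    have "(R has_real_derivative ?g s) (at s within {0..s + 1})"
      unfolding R_def[abs_def] using that by (intro integral_has_real_derivative g_cont) simp
    moreover have "at s within {0..s + 1} = at s" using that by (intro at_within_interior) simp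
    ultimately show ?thesis by simp
  qed
  have "(R has_real_derivative ?g 0) (at 0 within {0..1})"
    unfolding R_def[abs_def] by (intro integral_has_real_derivative g_cont) simp
  moreover have "R 0 = 0" by (simp add: R_def)
  ultimately have R_quotient: "((\<lambda>s. R s / s) \<longlongrightarrow> 1) (at_right 0)"
    by (simp add: has_field_derivative_iff at_within_Icc_at_right \<rho>_0)
  have R_0: "(R \<longlongrightarrow> 0) (at_right 0)"
  proof -
    have "((\<lambda>s. R s / s * s) \<longlongrightarrow> 1 * 0) (at_right 0)"
      by (intro tendsto_mult R_quotient tendsto_ident_at)
    moreover have "\<forall>\<^sub>F s in at_right 0. R s / s * s = R s"
      using eventually_at_right_less[of "0::real"] by eventually_elim simp
    ultimately show ?thesis using Lim_transform_eventually by fastforce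
  qed

  define A where "A s = ?g s * s * h (?c * ln s)" for s
  have A_pos: "A s > 0" if "s > 0" for s
    using g_pos[OF that] h_pos[of "?c * ln s"] that by (simp add: A_def)
  have A: "(A \<longlongrightarrow> ?c) at_top"
  proof -
    have "\<rho> \<sim>[at_top] (\<lambda>s. ?c\<^sup>2 / (s\<^sup>2 * (h (?c * ln s))\<^sup>2))"
      using law unfolding weight_law_def m(2,3) .
    moreover have "\<forall>\<^sub>F s in at_top. \<rho> s \<noteq> 0 \<or> ?c\<^sup>2 / (s\<^sup>2 * (h (?c * ln s))\<^sup>2) \<noteq> 0"
      using eventually_ge_at_top[of 0] by eventually_elim (use \<rho>_pos in force)
    ultimately have "((\<lambda>s. \<rho> s / (?c\<^sup>2 / (s\<^sup>2 * (h (?c * ln s))\<^sup>2))) \<longlongrightarrow> 1) at_top"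
      by (rule asymp_equivD_strong)
    then have "((\<lambda>s. ?c * sqrt (\<rho> s / (?c\<^sup>2 / (s\<^sup>2 * (h (?c * ln s))\<^sup>2)))) \<longlongrightarrow> ?c * sqrt 1) at_top"
      by (intro tendsto_intros)
    moreover have "\<forall>\<^sub>F s in at_top. ?c * sqrt (\<rho> s / (?c\<^sup>2 / (s\<^sup>2 * (h (?c * ln s))\<^sup>2))) = A s"
      using eventually_gt_at_top[of 0]
    proof eventually_elim
      case (elim s)
      have "\<rho> s / (?c\<^sup>2 / (s\<^sup>2 * (h (?c * ln s))\<^sup>2)) = \<rho> s * (s * h (?c * ln s) / ?c)\<^sup>2"
        by (simp add: power_mult_distrib power_divide)
      then have "sqrt (\<rho> s / (?c\<^sup>2 / (s\<^sup>2 * (h (?c * ln s))\<^sup>2))) = sqrt (\<rho> s) * \<bar>s * h (?c * ln s) / ?c\<bar>"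
        by (simp only: real_sqrt_mult real_sqrt_abs)
      also have "\<bar>s * h (?c * ln s) / ?c\<bar> = s * h (?c * ln s) / ?c"
        using elim m h_pos[of "?c * ln s"] by (intro abs_of_pos divide_pos_pos mult_pos_pos) simp_all
      also have "?c * (sqrt (\<rho> s) * (s * h (?c * ln s) / ?c)) = A s"
        using m \<rho>_pos[of s] elim by (simp add: A_def powr_half_sqrt less_imp_le)
      finally show ?case by simp
    qed
    ultimately have "(A \<longlongrightarrow> ?c * sqrt 1) at_top" by (rule Lim_transform_eventually)
    then show ?thesis by simp
  qed
  have \<sigma>_top: "filterlim (\<lambda>s. ?c * ln s) at_top at_top"
    by (rule filterlim_tendsto_pos_mult_at_top[OF tendsto_const m(5) ln_at_top])

  have h_cont: "isCont h \<tau>" for \<tau> using DERIV_isCont[OF admissible_DERIV[OF adm]] .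
  have inv_h_cont: "isCont (\<lambda>\<tau>. 1 / h \<tau>) \<tau>" for \<tau>
    using h_pos[of \<tau>] by (intro continuous_divide continuous_const h_cont) simp
  have "\<exists>H. \<forall>\<tau>. - \<infinity> < ereal \<tau> \<longrightarrow> ereal \<tau> < \<infinity> \<longrightarrow> (H has_vector_derivative 1 / h \<tau>) (at \<tau>)"
    by (rule einterval_antiderivative) (simp_all only: inv_h_cont, simp)
  then obtain H where "\<And>\<tau>. (H has_vector_derivative 1 / h \<tau>) (at \<tau>)" by auto
  then have H: "(H has_real_derivative 1 / h \<tau>) (at \<tau>)" for \<tau>
    by (simp only: has_real_derivative_iff_has_vector_derivative)
  have H_top: "filterlim H at_top at_top"
  proof (rule primitive_at_top_of_infinite_integral[OF H _ _ inf])
    show "(\<lambda>\<tau>. 1 / h \<tau>) \<in> borel_measurable borel"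
      by (intro borel_measurable_continuous_onI continuous_at_imp_continuous_on ballI inv_h_cont)
  qed (use h_pos in \<open>simp add: less_imp_le\<close>)
  have R_top: "filterlim R at_top at_top"
  proof -
    have "x / 2 < x" if "x > 0" for x :: real using that by simp
    from order_tendstoD(1)[OF A this[OF m(5)]] have "\<forall>\<^sub>F s in at_top. ?c / 2 < A s" .
    then obtain s1 where s1: "\<And>s. s \<ge> s1 \<Longrightarrow> ?c / 2 < A s" unfolding eventually_at_top_linorder by blast
    define s0 where "s0 = max s1 1"
    have s0: "s0 > 0" "\<And>s. s \<ge> s0 \<Longrightarrow> ?c / 2 < A s" using s1 by (auto simp: s0_def)
    \<comment> \<open>The derivative of \<open>H (?c * ln s)\<close> is \<open>?c / (s * h (?c * ln s))\<close>, which is \<open>R'\<close> up to the factor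
      \<open>?c / A s\<close>. This factor tends to 1, so the factor 1/2 makes \<open>?G\<close> grow more slowly than \<open>R\<close>.\<close>
    let ?G = "\<lambda>s. 1 / 2 * H (?c * ln s)"
    have "filterlim (\<lambda>s. (R s0 - ?G s0) + ?G s) at_top at_top"
      by (intro filterlim_tendsto_add_at_top[OF tendsto_const]
          filterlim_tendsto_pos_mult_at_top[OF tendsto_const] filterlim_compose[OF H_top \<sigma>_top]) simp
    then show ?thesis
    proof (rule filterlim_at_top_mono)
      show "\<forall>\<^sub>F s in at_top. (R s0 - ?G s0) + ?G s \<le> R s"
        using eventually_ge_at_top[of s0]
      proof eventually_elim
        case (elim s)
        have "R s0 - ?G s0 \<le> R s - ?G s"
        proof (rule DERIV_nonneg_imp_nondecreasing[OF elim])
          fix t assume t: "s0 \<le> t"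
          then have "t > 0" using s0(1) by simp
          have "((\<lambda>s. R s - ?G s) has_real_derivative ?g t - 1 / 2 * (1 / h (?c * ln t) * (?c * (1 / t)))) (at t)"
            by (intro DERIV_diff R' DERIV_cmult DERIV_chain2[OF H] DERIV_ln_divide \<open>t > 0\<close>)
          moreover have "?g t - 1 / 2 * (1 / h (?c * ln t) * (?c * (1 / t))) = (A t - ?c / 2) / (t * h (?c * ln t))"
            using \<open>t > 0\<close> h_pos[of "?c * ln t"] by (simp add: A_def diff_divide_distrib)
          moreover have "\<dots> \<ge> 0"
            using s0(2)[OF t] \<open>t > 0\<close> h_pos[of "?c * ln t"] by simp
          ultimately show "\<exists>y. ((\<lambda>s. R s - ?G s) has_real_derivative y) (at t) \<and> 0 \<le> y" by metis
        qed
        then show ?case by simp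
      qed
    qed
  qed

  obtain p where R_pos: "\<And>s. s > 0 \<Longrightarrow> R s > 0" and pR: "\<And>s. s > 0 \<Longrightarrow> p (R s) = s"
    and p_pos: "\<And>r. r > 0 \<Longrightarrow> p r > 0" and Rp: "\<And>r. r > 0 \<Longrightarrow> R (p r) = r"
    and p'_raw: "\<And>r. r > 0 \<Longrightarrow> (p has_real_derivative 1 / ?g (p r)) (at r)"
    and p0: "filterlim p (at_right 0) (at_right 0)" and p_top: "filterlim p at_top at_top"
    by (rule halfline_bijection_inverse[OF R' g_pos R_0 R_top]) blast+
  have rel: "rel_from_\<rho> \<rho> r s \<longleftrightarrow> s = p r" if "r > 0" "s > 0" for r s
  proof -
    have "rel_from_\<rho> \<rho> r s \<longleftrightarrow> r = R s"
      unfolding rel_from_\<rho>_def using R_integral has_integral_unique by metis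
    then show ?thesis using Rp[OF that(1)] pR[OF that(2)] by metis
  qed
  show "change_of_variables (rel_from_\<rho> \<rho>)"
    by (rule change_of_variables_of_inverse(1)[where q = p and p = R]) (fact rel p_pos Rp R_pos pR)+
  have the_s: "(THE s. s > 0 \<and> rel_from_\<rho> \<rho> r s) = p r" if "r > 0" for r
    by (rule change_of_variables_of_inverse(3)[where q = p and p = R]) (fact rel p_pos Rp R_pos pR that)+
  have p': "(p has_real_derivative \<rho> (p r) powr - (1 / 2)) (at r)" if "r > 0" for r
    using p'_raw[OF that] by (simp add: powr_minus_divide)
  have p_smooth: "C_infinity_on p {0<..}"
  proof (rule C_infinity_on_autonomous_ODE[where T = "{0<..}" and g = "\<lambda>s. \<rho> s powr - (1 / 2)"])
    show "C_infinity_on (\<lambda>s. \<rho> s powr - (1 / 2)) {0<..}"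
      by (rule C_infinity_on_powr_compose) (use \<rho>_smooth \<rho>_pos in \<open>simp_all add: less_imp_le\<close>)
  qed (use p' p_pos in simp_all)

  define Z where "Z s = s * \<rho> s powr b" for s
  define D where "D s = \<rho> s powr (b - 1 / 2) * (1 + b * (s * deriv \<rho> s / \<rho> s))" for s
  have Z_smooth: "C_infinity_on Z {0<..}"
    unfolding Z_def[abs_def]
    by (intro C_infinity_on_mult C_infinity_on_id C_infinity_on_powr_compose \<rho>_smooth)
      (use \<rho>_pos in \<open>simp_all add: less_imp_le\<close>)
  have Z_pos: "Z s > 0" if "s > 0" for s using that \<rho>_pos[of s] by (simp add: Z_def)
  have Zp_smooth: "C_infinity_on (\<lambda>r. Z (p r)) {0<..}"
    by (rule C_infinity_on_compose[OF _ _ p_smooth Z_smooth]) (use p_pos in simp_all)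
  have Zp': "((\<lambda>r. Z (p r)) has_real_derivative D (p r)) (at r)" if "r > 0" for r
  proof -
    let ?s = "p r"
    have pos: "?s > 0" "\<rho> ?s > 0" using p_pos[OF that] \<rho>_pos[of ?s] by simp_all
    have Z': "(Z has_real_derivative 1 * \<rho> ?s powr b + b * \<rho> ?s powr (b - of_nat 1) * deriv \<rho> ?s * ?s) (at ?s)"
      unfolding Z_def[abs_def]
      by (intro DERIV_mult DERIV_ident DERIV_fun_powr \<rho>_DERIV pos)
    have "\<rho> ?s powr (b - of_nat 1) = \<rho> ?s powr b / \<rho> ?s"
      using powr_diff[of "\<rho> ?s" b 1] pos by simp
    moreover have "\<rho> ?s powr (b - 1 / 2) = \<rho> ?s powr b * \<rho> ?s powr - (1 / 2)"
      using powr_add[of "\<rho> ?s" b "- (1 / 2)"] by simp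
    ultimately have "(1 * \<rho> ?s powr b + b * \<rho> ?s powr (b - of_nat 1) * deriv \<rho> ?s * ?s) * \<rho> ?s powr - (1 / 2) = D ?s"
      by (simp add: D_def algebra_simps)
    from DERIV_cong[OF DERIV_chain2[OF Z' p'[OF that]] this] show ?thesis .
  qed
  have powr_\<rho>_lim: "((\<lambda>s. \<rho> s powr e) \<longlongrightarrow> 1) (at_right 0)" for e
    using tendsto_powr[OF \<rho>_lim tendsto_const, of e] by simp
  have D_0: "(D \<longlongrightarrow> 1) (at_right 0)"
  proof -
    have "(D \<longlongrightarrow> 1 * (1 + b * (0 / 1))) (at_right 0)"
      unfolding D_def[abs_def] by (intro tendsto_intros powr_\<rho>_lim \<rho>'_0 \<rho>_lim) simp
    then show ?thesis by simp
  qed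
  have Z_quotient: "((\<lambda>r. Z (p r) / r) \<longlongrightarrow> 1) (at_right 0)"
  proof -
    have "((\<lambda>s. \<rho> s powr b / (R s / s)) \<longlongrightarrow> 1 / 1) (at_right 0)"
      by (intro tendsto_divide powr_\<rho>_lim R_quotient) simp
    then have "((\<lambda>r. \<rho> (p r) powr b / (R (p r) / p r)) \<longlongrightarrow> 1 / 1) (at_right 0)"
      by (rule filterlim_compose[OF _ p0])
    moreover have "\<forall>\<^sub>F r in at_right 0. \<rho> (p r) powr b / (R (p r) / p r) = Z (p r) / r"
      using eventually_at_right_less[of 0] by eventually_elim (simp add: Rp Z_def)
    ultimately have "((\<lambda>r. Z (p r) / r) \<longlongrightarrow> 1 / 1) (at_right 0)" by (rule Lim_transform_eventually)
    then show ?thesis by simp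
  qed
  have Z_0: "((\<lambda>r. Z (p r)) \<longlongrightarrow> 0) (at_right 0)"
  proof -
    have "((\<lambda>r. Z (p r) / r * r) \<longlongrightarrow> 1 * 0) (at_right 0)"
      by (intro tendsto_mult Z_quotient tendsto_ident_at)
    moreover have "\<forall>\<^sub>F r in at_right 0. Z (p r) / r * r = Z (p r)"
      using eventually_at_right_less[of "0::real"] by eventually_elim simp
    ultimately show ?thesis using Lim_transform_eventually by fastforce
  qed
  have Z_cont: "isCont (\<lambda>r. Z (p r)) r" if "r > 0" for r using DERIV_isCont[OF Zp'[OF that]] .
  have profile_eq: "(let s = THE s. s > 0 \<and> rel_from_\<rho> \<rho> r s in s * \<rho> s powr (1 / (2 * (real n - 1)))) = Z (p r)"
    if "r > 0" for r
    unfolding the_s[OF that] Let_def Z_def b_def m(2) ..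
  have profile_0: "profile_of n \<rho> 0 = 0"
    unfolding profile_of_def by (rule extend_to_0_at_0[OF profile_eq Z_cont Z_0])
  have profile: "profile_of n \<rho> r = Z (p r)" if "r > 0" for r
    unfolding profile_of_def by (rule extend_to_0_pos[OF profile_eq Z_cont Z_0 that])
  have profile': "(profile_of n \<rho> has_real_derivative D (p r)) (at r)" if "r > 0" for r
    by (rule has_field_derivative_transform_within_open[OF Zp'[OF that], of "{0<..}"])
      (use that in \<open>simp_all add: profile\<close>)
  have profile'_0: "(profile_of n \<rho> has_real_derivative 1) (at 0 within {0..})"
  proof -
    have "\<forall>\<^sub>F r in at_right 0. Z (p r) / r = profile_of n \<rho> r / r"
      using eventually_at_right_less[of 0] by eventually_elim (simp add: profile)
    with Z_quotient have "((\<lambda>r. profile_of n \<rho> r / r) \<longlongrightarrow> 1) (at_right 0)"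
      by (rule Lim_transform_eventually)
    then show ?thesis by (simp add: has_field_derivative_iff at_within_Ici_at_right profile_0)
  qed
  show "profile_of n \<rho> \<in> class_A"
    unfolding class_A_def
  proof (intro CollectI conjI allI impI)
    show "C_infinity_on (profile_of n \<rho>) {0<..}"
      by (rule C_infinity_on_cong[OF _ Zp_smooth]) (simp_all add: profile)
    show "C1_halfline (profile_of n \<rho>)"
      unfolding C1_halfline_def
    proof (intro exI conjI allI impI)
      \<comment> \<open>The derivative tends to 1 at the origin, in agreement with the difference quotient there.\<close>
      let ?f' = "extend_to_0 (\<lambda>r. D (p r))"
      have Dp_0: "((\<lambda>r. D (p r)) \<longlongrightarrow> 1) (at_right 0)" by (rule filterlim_compose[OF D_0 p0])
      have Dp_cont: "isCont (\<lambda>r. D (p r)) r" if "r > 0" for r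
      proof -
        have "C_infinity_on (\<lambda>r. D (p r)) {0<..}"
          by (rule C_infinity_on_cong[OF _ C_infinity_on_deriv[OF Zp_smooth]])
            (simp_all add: DERIV_imp_deriv[OF Zp'])
        from DERIV_isCont[OF C_infinity_on_imp_DERIV[OF this]] that show ?thesis by simp
      qed
      show "continuous_on {0..} ?f'"
        by (rule extend_to_0_continuous[OF refl Dp_cont Dp_0])
      have "?f' 0 = 1" by (rule extend_to_0_at_0[OF refl Dp_cont Dp_0])
      moreover have "?f' x = D (p x)" if "x > 0" for x using that by (simp add: extend_to_0_def)
      ultimately show "(profile_of n \<rho> has_real_derivative ?f' x) (at x within {0..})" if "x \<ge> 0" for x
        using that profile'_0 has_field_derivative_at_within[OF profile'[of x]] by (cases "x = 0") simp_all
    qed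
    show "profile_of n \<rho> r > 0" if "r > 0" for r using that Z_pos[OF p_pos[OF that]] by (simp add: profile)
  qed (fact profile'_0 profile_0)+

  let ?\<sigma> = "\<lambda>s. ?c * ln s"
  \<comment> \<open>Eliminate \<open>\<rho> s\<close> between the definitions of \<open>Z\<close> and \<open>A\<close>.\<close>
  have ln_Z: "ln (Z s) = ?\<sigma> s - ln (h (?\<sigma> s)) / (m + 1) + ln (A s) / (m + 1)" if "s > 0" for s
  proof -
    note pos = that \<rho>_pos[OF less_imp_le[OF that]] h_pos[of "?\<sigma> s"]
    have lnA: "ln (A s) = ln (\<rho> s) / 2 + ln s + ln (h (?\<sigma> s))"
      using pos by (simp add: A_def ln_mult_pos ln_powr)
    have lnZ: "ln (Z s) = ln s + ln (\<rho> s) / 2 / (m + 1)"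
      using pos by (simp add: Z_def ln_mult_pos ln_powr b_def)
    have "ln s = ln s * (m + 1) / (m + 1)" using m by simp
    then have c: "?\<sigma> s = ln s - ln s / (m + 1)"
      using m by (simp add: field_simps)
    show ?thesis unfolding lnA lnZ add_divide_distrib using c by linarith
  qed
  have ln_A_lim: "((\<lambda>s. ln (A s) / (m + 1)) \<longlongrightarrow> ln ?c / (m + 1)) at_top"
    using m by (intro tendsto_intros A) simp_all
  have ln_Z_top: "filterlim (\<lambda>s. ln (Z s)) at_top at_top"
  proof -
    have "filterlim (\<lambda>s. 1 * ?\<sigma> s + (- (1 / (m + 1))) * ln (h (?\<sigma> s))) at_top at_top"
      by (rule filterlim_compose[OF asymptotically_flat_linear_at_top[OF flat zero_less_one] \<sigma>_top])
    then have lim: "filterlim (\<lambda>s. ln (A s) / (m + 1) + (1 * ?\<sigma> s + (- (1 / (m + 1))) * ln (h (?\<sigma> s)))) at_top at_top"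
      by (rule filterlim_tendsto_add_at_top[OF ln_A_lim])
    show ?thesis
    proof (rule filterlim_at_top_mono[OF lim])
      show "\<forall>\<^sub>F s in at_top. ln (A s) / (m + 1) + (1 * ?\<sigma> s + (- (1 / (m + 1))) * ln (h (?\<sigma> s))) \<le> ln (Z s)"
        using eventually_gt_at_top[of 0] by eventually_elim (simp add: ln_Z)
    qed
  qed
  have "filterlim (\<lambda>s. exp (ln (Z s))) at_top at_top" by (rule filterlim_compose[OF exp_at_top ln_Z_top])
  then have "filterlim (\<lambda>r. exp (ln (Z (p r)))) at_top at_top" by (rule filterlim_compose[OF _ p_top])
  then show "filterlim (profile_of n \<rho>) at_top at_top"
  proof (rule filterlim_at_top_mono)
    show "\<forall>\<^sub>F r in at_top. exp (ln (Z (p r))) \<le> profile_of n \<rho> r"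
      using eventually_gt_at_top[of 0] by eventually_elim (use Z_pos p_pos profile in simp)
  qed

  have "((\<lambda>s. ln (h (ln (Z s))) - ln (h (?\<sigma> s))) \<longlongrightarrow> 0) at_top"
  proof (rule shifted_argument_backward[OF flat m(4) _ ln_Z_top \<sigma>_top])
    show "((\<lambda>\<tau>. ln (h (\<tau> + ln (h \<tau>) / (m + 1))) - ln (h \<tau>)) \<longlongrightarrow> 0) at_top"
      using admissible_shift[OF n adm] unfolding m(2) .
    have "\<forall>\<^sub>F s in at_top. \<bar>ln (A s) / (m + 1)\<bar> < \<bar>ln ?c / (m + 1)\<bar> + 1"
      by (rule order_tendstoD(2)[OF tendsto_rabs[OF ln_A_lim]]) simp
    then show "\<forall>\<^sub>F s in at_top. \<bar>ln (Z s) - (?\<sigma> s - ln (h (?\<sigma> s)) / (m + 1))\<bar> \<le> \<bar>ln ?c / (m + 1)\<bar> + 1"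
      using eventually_gt_at_top[of 0] by eventually_elim (simp add: ln_Z)
  qed
  moreover have "((\<lambda>s. s * deriv \<rho> s / \<rho> s) \<longlongrightarrow> - 2) at_top"
    using log_slope unfolding weight_log_slope_def .
  ultimately have "((\<lambda>s. (1 + b * (s * deriv \<rho> s / \<rho> s)) / A s * exp (- (ln (h (ln (Z s))) - ln (h (?\<sigma> s)))))
      \<longlongrightarrow> (1 + b * - 2) / ?c * exp (- 0)) at_top"
    using m by (intro tendsto_intros A) simp_all
  also have "(1 + b * - 2) / ?c * exp (- 0) = 1"
  proof -
    have "b * 2 = 1 / (m + 1)"
      using mult_divide_mult_cancel_left[of "2 :: real" 1 "m + 1"] by (simp add: b_def)
    moreover have "1 - 1 / (m + 1) = ?c" using m by (simp add: field_simps)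
    ultimately have "1 + b * - 2 = ?c" by simp
    then show ?thesis using m by simp
  qed
  finally have "((\<lambda>r. (1 + b * (p r * deriv \<rho> (p r) / \<rho> (p r))) / A (p r)
      * exp (- (ln (h (ln (Z (p r)))) - ln (h (?\<sigma> (p r)))))) \<longlongrightarrow> 1) at_top"
    by (rule filterlim_compose[OF _ p_top])
  moreover have "\<forall>\<^sub>F r in at_top. (1 + b * (p r * deriv \<rho> (p r) / \<rho> (p r))) / A (p r)
      * exp (- (ln (h (ln (Z (p r)))) - ln (h (?\<sigma> (p r)))))
      = deriv (\<lambda>x. ln (profile_of n \<rho> x)) r / h (ln (profile_of n \<rho> r))"
    using eventually_gt_at_top[of 0]
  proof eventually_elim
    case (elim r)
    let ?s = "p r" and ?e = "1 + b * (p r * deriv \<rho> (p r) / \<rho> (p r))"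
    have pos: "?s > 0" "\<rho> ?s > 0" "Z ?s > 0" "h (?\<sigma> ?s) > 0" "h (ln (Z ?s)) > 0"
      using p_pos[OF elim] \<rho>_pos[of ?s] Z_pos[of ?s] h_pos by simp_all
    have "((\<lambda>x. ln (profile_of n \<rho> x)) has_real_derivative 1 / profile_of n \<rho> r * D ?s) (at r)"
      using DERIV_chain2[OF DERIV_ln_divide profile'[OF elim]] pos(3) by (simp add: profile[OF elim])
    then have "deriv (\<lambda>x. ln (profile_of n \<rho> x)) r = D ?s / Z ?s"
      by (simp add: DERIV_imp_deriv profile[OF elim])
    also have "D ?s = ?e * \<rho> ?s powr b / ?g ?s"
      by (simp add: D_def powr_diff)
    also have "?e * \<rho> ?s powr b / ?g ?s / Z ?s = ?e / (?g ?s * ?s)"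
      using pos by (simp add: Z_def)
    also have "\<dots> = ?e / A ?s * h (?\<sigma> ?s)"
      using pos by (simp add: A_def)
    finally show ?case using pos by (simp add: exp_diff profile[OF elim])
  qed
  ultimately show "profile_law h (profile_of n \<rho>)"
    unfolding profile_law_def by (rule Lim_transform_eventually)
qed

section \<open>The correspondence\<close>

theorem theorem7p1:
  fixes n :: nat
  assumes "n \<ge> 3"
  shows "(\<forall>\<psi> h. \<psi> \<in> class_A \<and> filterlim \<psi> at_top at_top \<and> admissible n h \<and> profile_law h \<psi> \<longrightarrow>
            change_of_variables (rel_from_\<psi> n \<psi>) \<and>
            weight_of n \<psi> \<in> class_B \<and>
            weight_law n h (weight_of n \<psi>) \<and>
            weight_log_slope (weight_of n \<psi>)) \<and>
         (\<forall>\<rho> h. \<rho> \<in> class_B \<and> weight_log_slope \<rho> \<and> admissible n h \<and> weight_law n h \<rho> \<and>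
            (\<integral>\<^sup>+\<tau>\<in>{1..}. ennreal (1 / h \<tau>) \<partial>lborel) = \<infinity> \<longrightarrow>
            change_of_variables (rel_from_\<rho> \<rho>) \<and>
            profile_of n \<rho> \<in> class_A \<and>
            filterlim (profile_of n \<rho>) at_top at_top \<and>
            profile_law h (profile_of n \<rho>))"
  by (intro conjI allI impI; elim conjE;
      rule weight_of_profile[OF assms] profile_of_weight[OF assms]; assumption)

end
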